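(* Let $A \subset \mathbb{R}$ be finite and let $\delta = 1/4$. Then there exist $B, C$ that partition $A$ with $$\max\{d^{+}(B), d^{\times}(C)\} \lesssim |A|^{1-2\delta}.$$ Furthermore, $$\max\{E^{+}(B), E^{\times}(C)\} \lesssim |A|^{3 - \frac{14}{13}\delta}, \qquad \max\{E^{+}(B,A), E^{\times}(C,A)\} \lesssim |A|^{3-\delta}.$$
   Context: For finite $A,B\subset\mathbb{R}$ and $x\in\mathbb{R}$, let $r_{A-B}(x) = \#\{(a,b)\in A\times B : x = a-b\}$ and $r_{A/B}(x) = \#\{(a,b)\in A\times B : a = xb\}$. The additive and multiplicative energies are $E^+(A,B)=\sum_x r_{A-B}(x)^2$, $E^{\times}(A,B)=\sum_x r_{A/B}(x)^2$, with $E^+(A)=E^+(A,A)$, $E^\times(A)=E^\times(A,A)$. Define $E_3^+(A,B)=\sum_x r_{A-B}(x)^3$ and $E_3^{\times}(A,B)=\sum_x r_{A/B}(x)^3$, and for finite nonempty $A$, $d^+(A) = \sup_{B} \frac{E_3^+(A,B)}{|A||B|^2}$, $d^{\times}(A) = \sup_{B} \frac{E_3^{\times}(A,B)}{|A||B|^2}$, the suprema over all finite nonempty $B\subset\mathbb{R}$. The notation $a \lesssim b$ means $a = O(b \log^c |A|)$ for some absolute constant $c>0$. *)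

theory Defs
  imports "HOL-Analysis.Analysis"
begin

definition r_diff :: "real set \<Rightarrow> real set \<Rightarrow> real \<Rightarrow> nat" where
  "r_diff A B x = card {(a, b). a \<in> A \<and> b \<in> B \<and> x = a - b}"

definition r_quot :: "real set \<Rightarrow> real set \<Rightarrow> real \<Rightarrow> nat" where
  "r_quot A B x = card {(a, b). a \<in> A \<and> b \<in> B \<and> a = x * b}"

text \<open>
  The energies are sums over all real \<open>x\<close>, taken in \<^typ>\<open>ennreal\<close>, where every such
  sum exists. If \<open>0 \<in> A \<inter> B\<close> then \<open>r_quot A B x \<ge> 1\<close> for every \<open>x\<close>, and the
  multiplicative energies of finite \<open>A\<close> and \<open>B\<close> are \<open>\<infinity>\<close>; in all other cases the
  energies of finite sets are sums with finite support.
\<close>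

definition E_add :: "real set \<Rightarrow> real set \<Rightarrow> ennreal" where
  "E_add A B = (\<Sum>\<^sub>\<infinity>x\<in>UNIV. of_nat (r_diff A B x) ^ 2)"

definition E_mult :: "real set \<Rightarrow> real set \<Rightarrow> ennreal" where
  "E_mult A B = (\<Sum>\<^sub>\<infinity>x\<in>UNIV. of_nat (r_quot A B x) ^ 2)"

definition E3_add :: "real set \<Rightarrow> real set \<Rightarrow> ennreal" where
  "E3_add A B = (\<Sum>\<^sub>\<infinity>x\<in>UNIV. of_nat (r_diff A B x) ^ 3)"

definition E3_mult :: "real set \<Rightarrow> real set \<Rightarrow> ennreal" where
  "E3_mult A B = (\<Sum>\<^sub>\<infinity>x\<in>UNIV. of_nat (r_quot A B x) ^ 3)"

text \<open>
  For \<open>A = {}\<close> the quotients below are \<open>0 / 0 = 0\<close>, so \<open>d_add {} = d_mult {} = 0\<close>.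
\<close>

definition d_add :: "real set \<Rightarrow> ennreal" where
  "d_add A = (SUP B\<in>{B. finite B \<and> B \<noteq> {}}.
     E3_add A B / (of_nat (card A) * of_nat (card B) ^ 2))"

definition d_mult :: "real set \<Rightarrow> ennreal" where
  "d_mult A = (SUP B\<in>{B. finite B \<and> B \<noteq> {}}.
     E3_mult A B / (of_nat (card A) * of_nat (card B) ^ 2))"

end

theory Submission
  imports Defs "HOL-Library.Z2"
begin

text \<open>
  If the additive cubic energy of \<open>B\<close> against some \<open>X\<close> exceeds \<open>D * card B * (card X)\<^sup>2\<close>,
  then many elements of \<open>B\<close> have many representations \<open>a = s + x\<close> with \<open>s\<close> a popular
  difference. For such \<open>a\<close> the solutions of \<open>a = y c\<close> give incidences of the points \<open>(c, s)\<close>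
  with the lines \<open>s = y c - x\<close>, so the Szemeredi--Trotter bound for Cartesian products controls
  the multiplicative cubic energies of this part of \<open>B\<close>. Removing such parts until none is
  left, with \<open>D = sqrt (card A)\<close>, gives the partition. The bounds for \<open>E(B, A)\<close> follow by
  Cauchy--Schwarz. The exponent \<open>3 - 14/13 \<delta>\<close> comes from the inequality
  \<open>E(A) \<lesssim> d(A)\<^bsup>7/13\<^esup> (card A)\<^bsup>32/13\<^esup>\<close> in an arbitrary abelian group, which is proved by
  counting triples \<open>x, y, z \<in> A\<close> with \<open>x - y\<close> and \<open>x - z\<close> popular, weighted by the number of
  representations of \<open>y - z\<close>.
\<close>

section \<open>Dyadic decomposition and elementary inequalities\<close>

text \<open>The value \<open>sqrt (card A)\<close> is a balance point: what remains has additive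
  constant \<open>D\<close>, while the union of the removed parts has multiplicative constant about
  \<open>card A / D\<close>. The obstacle is this union, as no logarithmic bound on the number of
  parts is available. It is overcome because a part \<open>A\<close> removed from \<open>B\<close>
  has, up to logarithms, the constant \<open>(card A)^2 / (D * card B)\<close>, which is tiny for
  small parts, and such bounds can be added in the l^3 norm. With n = \<open>card A\<close> and d
  about n^(1/2), the inequality E^26 <= d^14 n^64 yields the exponent 71/26 = 3 - 14/13 * 1/4, and
  E(B,A)^2 <= d n^5 yields 11/4 = 3 - 1/4. Every logarithm stems from dyadic levels counted by one
  common \<open>L\<close>; \<open>powr\<close> and infinite sums enter only in the last
  section.\<close>

lemma dyadic_sum_le:
  fixes g :: "'a \<Rightarrow> real" and r :: "'a \<Rightarrow> nat"
  assumes "finite X" "\<And>x. x \<in> X \<Longrightarrow> 1 \<le> r x" "\<And>x. x \<in> X \<Longrightarrow> r x < 2 ^ L"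
    and "\<And>j. j < L \<Longrightarrow> (\<Sum>x | x \<in> X \<and> 2 ^ j \<le> r x \<and> r x < 2 ^ Suc j. g x) \<le> M"
  shows "sum g X \<le> real L * M"
  using assms
proof (induction L arbitrary: X)
  case 0
  then have "X = {}" by fastforce
  then show ?case by simp
next
  case (Suc L)
  define X1 where "X1 = {x \<in> X. r x < 2 ^ L}"
  define X2 where "X2 = {x. x \<in> X \<and> 2 ^ L \<le> r x \<and> r x < 2 ^ Suc L}"
  have X: "X = X1 \<union> X2" "X1 \<inter> X2 = {}" "finite X1" "finite X2"
    using Suc.prems by (auto simp: X1_def X2_def)
  have "sum g X1 \<le> real L * M"
  proof (rule Suc.IH)
    fix j assume j: "j < L"
    then have "(2::nat) ^ Suc j \<le> 2 ^ L" by (intro power_increasing) auto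
    then have "{x. x \<in> X1 \<and> 2 ^ j \<le> r x \<and> r x < 2 ^ Suc j}
        = {x. x \<in> X \<and> 2 ^ j \<le> r x \<and> r x < 2 ^ Suc j}"
      by (auto simp: X1_def)
    then show "(\<Sum>x | x \<in> X1 \<and> 2 ^ j \<le> r x \<and> r x < 2 ^ Suc j. g x) \<le> M"
      using Suc.prems(4)[of j] j by simp
  qed (use Suc.prems(1,2) in \<open>auto simp: X1_def\<close>)
  moreover have "sum g X2 \<le> M"
    using Suc.prems(4)[of L] by (simp add: X2_def)
  ultimately show ?case
    unfolding X(1) using X(2-4) by (simp add: sum.union_disjoint algebra_simps)
qed

lemma dyadic_pigeonhole:
  fixes g :: "'a \<Rightarrow> real" and r :: "'a \<Rightarrow> nat"
  assumes "finite X" "\<And>x. x \<in> X \<Longrightarrow> 1 \<le> r x" "\<And>x. x \<in> X \<Longrightarrow> r x < 2 ^ L" "0 < sum g X"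
  obtains j where "j < L"
    "sum g X \<le> real L * (\<Sum>x | x \<in> X \<and> 2 ^ j \<le> r x \<and> r x < 2 ^ Suc j. g x)"
proof -
  let ?S = "\<lambda>j. \<Sum>x | x \<in> X \<and> 2 ^ j \<le> r x \<and> r x < 2 ^ Suc j. g x"
  \<comment> \<open>Positivity of the sum rules out \<open>L = 0\<close>, where there is no level to
    choose.\<close>
  have "L \<noteq> 0"
  proof
    assume "L = 0"
    then have "X = {}" using assms(2,3) by fastforce
    then show False using assms(4) by simp
  qed
  then have ne: "finite (?S ` {..<L})" "?S ` {..<L} \<noteq> {}" by auto
  from Max_in[OF ne] obtain j where j: "j < L" "?S j = Max (?S ` {..<L})" by fastforce
  have "sum g X \<le> real L * Max (?S ` {..<L})"
  proof (rule dyadic_sum_le[OF assms(1-3)])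
    fix j assume "j < L"
    then show "?S j \<le> Max (?S ` {..<L})" by (intro Max_ge[OF ne(1)] imageI) simp
  qed
  then show ?thesis unfolding j(2)[symmetric] by (rule that[OF j(1)])
qed

lemma sum_cube_le:
  fixes f :: "'a \<Rightarrow> real"
  assumes "\<And>x. x \<in> X \<Longrightarrow> 0 \<le> f x"
  shows "(sum f X) ^ 3 \<le> real (card X) ^ 2 * (\<Sum>x\<in>X. f x ^ 3)"
proof (cases "card X = 0")
  case True
  \<comment> \<open>This case includes infinite \<open>X\<close>, where both \<open>card\<close> and
    \<open>sum\<close> take the default value 0.\<close>
  then have "sum f X = 0" by (cases "finite X") auto
  then show ?thesis using True by simp
next
  case False
  define m where "m = sum f X / card X"
  have m0: "0 \<le> m" using assms by (simp add: m_def sum_nonneg)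
  have m: "sum f X = card X * m" using False by (simp add: m_def)
  \<comment> \<open>The cube lies above its tangent at the mean \<open>m\<close>; (t - m)^2 (t + 2m)
    is the difference t^3 - 3 m^2 t + 2 m^3.\<close>
  have "0 \<le> (\<Sum>x\<in>X. (f x - m)^2 * (f x + 2 * m))"
    using assms m0 by (intro sum_nonneg) auto
  also have "\<dots> = (\<Sum>x\<in>X. f x ^ 3 - 3 * m^2 * f x + 2 * m ^ 3)"
    by (intro sum.cong) (auto simp: power2_eq_square power3_eq_cube algebra_simps)
  also have "\<dots> = (\<Sum>x\<in>X. f x ^ 3) - 3 * m^2 * sum f X + card X * (2 * m^3)"
    by (simp add: sum.distrib sum_subtractf sum_distrib_left)
  also have "\<dots> = (\<Sum>x\<in>X. f x ^ 3) - card X * m ^ 3"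
    by (simp add: m power2_eq_square power3_eq_cube algebra_simps)
  finally have "card X * m ^ 3 \<le> (\<Sum>x\<in>X. f x ^ 3)" by simp
  then have "real (card X)^2 * (card X * m ^ 3) \<le> real (card X)^2 * (\<Sum>x\<in>X. f x ^ 3)"
    by (intro mult_left_mono) auto
  moreover have "(sum f X) ^ 3 = real (card X)^2 * (card X * m ^ 3)"
    by (simp add: m power2_eq_square power3_eq_cube algebra_simps)
  ultimately show ?thesis by simp
qed

lemma sum_sq_le:
  fixes f :: "'a \<Rightarrow> real"
  shows "(sum f X)\<^sup>2 \<le> real (card X) * (\<Sum>x\<in>X. (f x)\<^sup>2)"
  using Cauchy_Schwarz_ineq_sum[of "\<lambda>_. 1" f X] by simp

text \<open>Convexity of the cube at \<open>f x / u\<close> and \<open>g x / v\<close> with weights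
  u/(u+v) and v/(u+v); the divisions force the cases \<open>u = 0\<close> and \<open>v = 0\<close>
  apart. Upper bounds of the form \<open>u ^ 3\<close> spare the caller the cube roots of the
  sums.\<close>

lemma Minkowski_cube:
  fixes f g :: "'a \<Rightarrow> real"
  assumes "finite X" "\<And>x. x \<in> X \<Longrightarrow> 0 \<le> f x" "\<And>x. x \<in> X \<Longrightarrow> 0 \<le> g x"
    and "(\<Sum>x\<in>X. f x ^ 3) \<le> u ^ 3" "(\<Sum>x\<in>X. g x ^ 3) \<le> v ^ 3" "0 \<le> u" "0 \<le> v"
  shows "(\<Sum>x\<in>X. (f x + g x) ^ 3) \<le> (u + v) ^ 3"
proof -
  consider "u = 0" | "v = 0" | "u > 0" "v > 0" using assms by linarith
  then show ?thesis
  proof cases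
    case 1
    then have "(\<Sum>x\<in>X. f x ^ 3) = 0"
      using assms by (intro antisym sum_nonneg) auto
    then have "\<forall>x\<in>X. f x = 0" using assms by (subst (asm) sum_nonneg_eq_0_iff) auto
    then show ?thesis using assms 1 by simp
  next
    case 2
    then have "(\<Sum>x\<in>X. g x ^ 3) = 0"
      using assms by (intro antisym sum_nonneg) auto
    then have "\<forall>x\<in>X. g x = 0" using assms by (subst (asm) sum_nonneg_eq_0_iff) auto
    then show ?thesis using assms 2 by simp
  next
    case 3
    have conv: "(u * s + v * t) ^ 3 \<le> (u + v)^2 * (u * s ^ 3 + v * t ^ 3)"
      if "0 \<le> s" "0 \<le> t" for s t :: real
    proof -
      have "(u + v)^2 * (u * s ^ 3 + v * t ^ 3) - (u * s + v * t) ^ 3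
          = u * v * (s - t)^2 * (2 * u * s + u * t + v * s + 2 * v * t)"
        by (simp add: power2_eq_square power3_eq_cube algebra_simps)
      also have "\<dots> \<ge> 0" using that 3 by (intro mult_nonneg_nonneg add_nonneg_nonneg) auto
      finally show ?thesis by simp
    qed
    have "(\<Sum>x\<in>X. (f x + g x) ^ 3) \<le> (\<Sum>x\<in>X. (u+v)^2 * (u * (f x / u) ^ 3 + v * (g x / v) ^ 3))"
    proof (intro sum_mono)
      fix x assume "x \<in> X"
      then show "(f x + g x) ^ 3 \<le> (u+v)^2 * (u * (f x / u) ^ 3 + v * (g x / v) ^ 3)"
        using conv[of "f x / u" "g x / v"] assms(2,3) 3 by simp
    qed
    also have "\<dots> = (u+v)^2 * (u * ((\<Sum>x\<in>X. f x ^ 3) / u ^ 3) + v * ((\<Sum>x\<in>X. g x ^ 3) / v ^ 3))"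
      by (simp add: sum_distrib_left sum.distrib sum_divide_distrib power_divide algebra_simps)
    also have "\<dots> \<le> (u+v)^2 * (u * 1 + v * 1)"
      using 3 assms by (intro mult_left_mono add_mono) auto
    also have "\<dots> = (u + v) ^ 3" by (simp add: power2_eq_square power3_eq_cube)
    finally show ?thesis .
  qed
qed

section \<open>Rich lines in Cartesian products\<close>

lemma finite_real_blocks:
  fixes Y :: "real set"
  assumes "finite Y" "1 \<le> r" "r \<le> card Y"
  obtains \<beta> :: "real \<Rightarrow> nat" where "mono \<beta>" "\<And>c. c \<in> Y \<Longrightarrow> \<beta> c < r"
    "\<And>j. r * card {c \<in> Y. \<beta> c = j} \<le> 2 * card Y"
proof -
  define \<rho> where "\<rho> c = card {c' \<in> Y. c' < c}" for c
  \<comment> \<open>Blocks are intervals of ranks of length \<open>m\<close>. The + 1 makes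
    \<open>r * m\<close> exceed \<open>card Y\<close>, so block numbers stay below \<open>r\<close>,
    and \<open>r * m <= card Y + r <= 2 * card Y\<close> bounds the block sizes.\<close>
  define m where "m = card Y div r + 1"
  define \<beta> where "\<beta> c = \<rho> c div m" for c
  have mono\<rho>: "\<rho> c \<le> \<rho> c'" if "c \<le> c'" for c c'
    unfolding \<rho>_def using that assms by (intro card_mono) auto
  have less\<rho>: "\<rho> c < \<rho> c'" if "c < c'" "c \<in> Y" for c c'
    unfolding \<rho>_def using that assms by (intro psubset_card_mono) auto
  then have inj: "inj_on \<rho> Y"
    by (metis inj_onI less_irrefl linorder_neqE)
  have "mono \<beta>" unfolding \<beta>_def by (auto intro!: monoI div_le_mono mono\<rho>)
  moreover have "\<beta> c < r" if "c \<in> Y" for c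
  proof -
    have "\<rho> c < card Y" unfolding \<rho>_def using that assms by (intro psubset_card_mono) auto
    also have "card Y < r * m" using assms(2) unfolding m_def
      using dividend_less_times_div[of r "card Y"] by simp
    finally show ?thesis by (simp add: \<beta>_def less_mult_imp_div_less)
  qed
  moreover have "r * card {c \<in> Y. \<beta> c = j} \<le> 2 * card Y" for j
  proof -
    have "card {c \<in> Y. \<beta> c = j} = card (\<rho> ` {c \<in> Y. \<beta> c = j})"
      by (intro card_image[symmetric] inj_on_subset[OF inj]) auto
    also have "\<dots> \<le> card {j * m ..< j * m + m}"
    proof (intro card_mono subsetI)
      fix k assume "k \<in> \<rho> ` {c \<in> Y. \<beta> c = j}"
      then have k: "j = k div m" by (auto simp: \<beta>_def)
      have "m > 0" by (simp add: m_def)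
      then show "k \<in> {j * m ..< j * m + m}"
        unfolding k using dividend_less_div_times[of m k] by auto
    qed auto
    finally have "card {c \<in> Y. \<beta> c = j} \<le> m" by simp
    then have "r * card {c \<in> Y. \<beta> c = j} \<le> r * m" by simp
    also have "\<dots> \<le> card Y + r" by (simp add: m_def algebra_simps)
    finally show ?thesis using assms(3) by linarith
  qed
  ultimately show ?thesis using that by blast
qed

text \<open>Along a line both cell coordinates are monotone, in the same sense for positive slope
  and in opposite senses for negative slope. So u + v, respectively u + r - v, determines the cell,
  and it takes values below 2r; v < r keeps the natural subtraction exact.\<close>

lemma line_meets_few_cells:
  fixes \<beta> \<gamma> :: "real \<Rightarrow> nat"
  assumes mono: "mono \<beta>" "mono \<gamma>" and y: "y \<noteq> 0" and "finite I"
    and bound: "\<And>c. c \<in> I \<Longrightarrow> \<beta> c < r" "\<And>c. c \<in> I \<Longrightarrow> \<gamma> (y * c - x) < r"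
  shows "card ((\<lambda>c. (\<beta> c, \<gamma> (y * c - x))) ` I) \<le> 2 * r"
proof -
  let ?\<kappa> = "\<lambda>c. (\<beta> c, \<gamma> (y * c - x))"
  define g where "g = (\<lambda>(u, v). if y > 0 then u + v else u + r - (v::nat))"
  have "inj_on g (?\<kappa> ` I)"
  proof -
    have main: "?\<kappa> c = ?\<kappa> c'" if "c \<in> I" "c' \<in> I" "c \<le> c'" "g (?\<kappa> c) = g (?\<kappa> c')" for c c'
    proof (cases "y > 0")
      case True
      have "\<beta> c \<le> \<beta> c'" using that mono(1) by (auto dest: monoD)
      moreover have "\<gamma> (y * c - x) \<le> \<gamma> (y * c' - x)"
        using that mono(2) True by (intro monoD[OF mono(2)]) auto
      ultimately show ?thesis using that True by (auto simp: g_def)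
    next
      case False
      have "\<beta> c \<le> \<beta> c'" using that mono(1) by (auto dest: monoD)
      moreover have "\<gamma> (y * c - x) \<ge> \<gamma> (y * c' - x)"
        using that mono(2) False by (intro monoD[OF mono(2)]) (auto simp: mult_left_mono_neg)
      ultimately show ?thesis using that(4) False bound(2)[OF that(1)] bound(2)[OF that(2)]
        by (auto simp: g_def)
    qed
    show ?thesis
    proof (rule inj_onI)
      fix p q assume "p \<in> ?\<kappa> ` I" "q \<in> ?\<kappa> ` I" and e: "g p = g q"
      then obtain c c' where "c \<in> I" "c' \<in> I" "p = ?\<kappa> c" "q = ?\<kappa> c'" by blast
      then show "p = q" using main[of c c'] main[of c' c] e by (cases "c \<le> c'") auto
    qed
  qed
  moreover have "g ` ?\<kappa> ` I \<subseteq> {..<2 * r}"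
    using bound by (fastforce simp: g_def)
  ultimately show ?thesis
    using card_inj_on_le[of g "?\<kappa> ` I" "{..<2 * r}"] by simp
qed

text \<open>
  Szemeredi--Trotter for Cartesian products by the Solymosi--Vu argument: cut the grid into
  \<open>r\<^sup>2\<close> cells; a line meets at most \<open>2 r\<close> of them, so a line with \<open>4 r\<close> points has
  at least \<open>2 r\<close> pairs of points in a common cell, and a pair determines its line.
\<close>

lemma rich_lines_bound:
  fixes Y S :: "real set"
  assumes fin: "finite Y" "finite S" "finite \<Lambda>" and r: "1 \<le> r"
    and nz: "\<And>y x. (y, x) \<in> \<Lambda> \<Longrightarrow> y \<noteq> 0"
    and rich: "\<And>y x. (y, x) \<in> \<Lambda> \<Longrightarrow> 4 * r \<le> card {c \<in> Y. y * c - x \<in> S}"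
  shows "card \<Lambda> * r ^ 3 \<le> 2 * (card Y)\<^sup>2 * (card S)\<^sup>2"
proof (cases "\<Lambda> = {}")
  case False
  define I where "I = (\<lambda>(y, x). {c \<in> Y. y * c - x \<in> S})"
  have finI: "finite (I l)" for l using fin by (auto simp: I_def split: prod.split)
  have cS: "card (I (y, x)) \<le> card S" if "y \<noteq> 0" for y x
    using that fin unfolding I_def
    by (intro card_inj_on_le[of "\<lambda>c. y * c - x"]) (auto simp: inj_on_def)
  have cY: "card (I l) \<le> card Y" for l
    using fin unfolding I_def by (intro card_mono) (auto split: prod.split)
  have rI: "4 * r \<le> card (I l)" if "l \<in> \<Lambda>" for l
    using rich that by (cases l) (auto simp: I_def)
  obtain y0 x0 where l0: "(y0, x0) \<in> \<Lambda>" using False by auto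
  have rY: "r \<le> card Y" using rI[OF l0] cY[of "(y0, x0)"] by linarith
  have rS: "r \<le> card S" using rI[OF l0] cS[OF nz[OF l0], of x0] by linarith
  obtain \<beta> :: "real \<Rightarrow> nat" where \<beta>: "mono \<beta>" "\<And>c. c \<in> Y \<Longrightarrow> \<beta> c < r"
    "\<And>j. r * card {c \<in> Y. \<beta> c = j} \<le> 2 * card Y"
    using finite_real_blocks[OF fin(1) r rY] by blast
  obtain \<gamma> :: "real \<Rightarrow> nat" where \<gamma>: "mono \<gamma>" "\<And>c. c \<in> S \<Longrightarrow> \<gamma> c < r"
    "\<And>j. r * card {c \<in> S. \<gamma> c = j} \<le> 2 * card S"
    using finite_real_blocks[OF fin(2) r rS] by blast
  define \<kappa> where "\<kappa> = (\<lambda>(y, x) c. (\<beta> c, \<gamma> (y * c - x)))"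
  define W where "W l = {(c, c') \<in> I l \<times> I l. c \<noteq> c' \<and> \<kappa> l c = \<kappa> l c'}" for l
  have finW: "finite (W l)" for l
    by (rule finite_subset[of _ "I l \<times> I l"]) (auto simp: W_def finI)
  have W: "2 * r \<le> card (W l)" if l: "l \<in> \<Lambda>" for l
  proof -
    \<comment> \<open>One representative for each occupied cell. Each of the at least 4r - 2r other
      points forms a pair with the representative of its cell.\<close>
    define R where "R = inv_into (I l) (\<kappa> l) ` \<kappa> l ` I l"
    have "card (\<kappa> l ` I l) \<le> 2 * r"
    proof (cases l)
      case (Pair y x)
      show ?thesis unfolding Pair \<kappa>_def prod.case
        by (rule line_meets_few_cells)
          (use \<beta> \<gamma> nz l Pair finI in \<open>auto simp: I_def\<close>)
    qed
    moreover have "card R \<le> card (\<kappa> l ` I l)" unfolding R_def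
      by (intro card_image_le) (simp add: finI)
    ultimately have "2 * r \<le> card (I l - R)"
      using rI[OF l] diff_card_le_card_Diff[of R "I l"] finI by (simp add: R_def)
    also have "\<dots> \<le> card (W l)"
    proof (rule card_inj_on_le[of "\<lambda>c. (c, inv_into (I l) (\<kappa> l) (\<kappa> l c))"])
      show "(\<lambda>c. (c, inv_into (I l) (\<kappa> l) (\<kappa> l c))) ` (I l - R) \<subseteq> W l"
      proof
        fix p assume "p \<in> (\<lambda>c. (c, inv_into (I l) (\<kappa> l) (\<kappa> l c))) ` (I l - R)"
        then obtain c where c: "c \<in> I l" "c \<notin> R" "p = (c, inv_into (I l) (\<kappa> l) (\<kappa> l c))"
          by auto
        then have "inv_into (I l) (\<kappa> l) (\<kappa> l c) \<in> R" by (auto simp: R_def)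
        then show "p \<in> W l" using c
          by (auto simp: W_def f_inv_into_f inv_into_into)
      qed
    qed (auto simp: inj_on_def finW)
    finally show ?thesis .
  qed
  \<comment> \<open>All pairs of grid points in a common cell. Each point has at most (2
    \<open>card Y\<close> / r)(2 \<open>card S\<close> / r) partners.\<close>
  define Q where "Q = (SIGMA p : Y \<times> S. {c \<in> Y. \<beta> c = \<beta> (fst p)} \<times> {s \<in> S. \<gamma> s = \<gamma> (snd p)})"
  have finQ: "finite Q" unfolding Q_def using fin by (intro finite_SigmaI) auto
  have "card \<Lambda> * (2 * r) \<le> (\<Sum>l\<in>\<Lambda>. card (W l))"
    using sum_bounded_below[of \<Lambda> "2 * r" "\<lambda>l. card (W l)"] W by simp
  also have "\<dots> = card (Sigma \<Lambda> W)" using fin finW by simp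
  also have "\<dots> \<le> card Q"
  proof (rule card_inj_on_le[of "\<lambda>((y, x), (c, c')). ((c, y * c - x), (c', y * c' - x))"])
    show "inj_on (\<lambda>((y, x), (c, c')). ((c, y * c - x), (c', y * c' - x))) (Sigma \<Lambda> W)"
    proof -
      have two_points: "y = y' \<and> x = x'"
        if "c \<noteq> c'" "y * c - x = y' * c - x'" "y * c' - x = y' * c' - x'"
        for y x c c' y' x' :: real
      proof -
        have "(y - y') * (c - c') = (y * c - x) - (y * c' - x) - ((y' * c - x') - (y' * c' - x'))"
          by (simp add: left_diff_distrib right_diff_distrib)
        then have "(y - y') * (c - c') = 0" unfolding that(2,3) by simp
        then show ?thesis using that by simp
      qed
      show ?thesis
      proof (rule inj_onI, goal_cases)
        case (1 p q)
        obtain y x c c' y' x' d d'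
          where pq: "p = ((y, x), (c, c'))" "q = ((y', x'), (d, d'))"
          by (metis prod.exhaust)
        have "c \<noteq> c'" using 1(1) by (simp add: pq W_def)
        have d: "d = c" "d' = c'" using 1(3) by (simp_all add: pq)
        have "y * c - x = y' * c - x'" "y * c' - x = y' * c' - x'"
          using 1(3) d by (simp_all add: pq)
        from two_points[OF \<open>c \<noteq> c'\<close> this] show "p = q" by (simp add: pq d)
      qed
    qed
    show "(\<lambda>((y, x), (c, c')). ((c, y * c - x), (c', y * c' - x))) ` Sigma \<Lambda> W \<subseteq> Q"
      by (auto simp: W_def Q_def I_def \<kappa>_def)
  qed (rule finQ)
  finally have 1: "card \<Lambda> * (2 * r) \<le> card Q" .
  have "r\<^sup>2 * card Q = (\<Sum>p\<in>Y\<times>S. (r * card {c \<in> Y. \<beta> c = \<beta> (fst p)})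
      * (r * card {s \<in> S. \<gamma> s = \<gamma> (snd p)}))"
    using fin unfolding Q_def
    by (simp add: card_cartesian_product sum_distrib_left power2_eq_square ac_simps)
  also have "\<dots> \<le> (\<Sum>p\<in>Y\<times>S. (2 * card Y) * (2 * card S))"
    by (intro sum_mono mult_mono[OF \<beta>(3) \<gamma>(3)]) simp_all
  also have "\<dots> = 4 * (card Y)\<^sup>2 * (card S)\<^sup>2"
    by (simp add: card_cartesian_product power2_eq_square)
  finally have "r\<^sup>2 * card Q \<le> 4 * (card Y)\<^sup>2 * (card S)\<^sup>2" .
  moreover have "r\<^sup>2 * (card \<Lambda> * (2 * r)) \<le> r\<^sup>2 * card Q" using 1 by (rule mult_left_mono) simp
  ultimately have "r\<^sup>2 * (card \<Lambda> * (2 * r)) \<le> 4 * (card Y)\<^sup>2 * (card S)\<^sup>2"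
    by (rule order_trans[rotated])
  moreover have "r\<^sup>2 * (card \<Lambda> * (2 * r)) = 2 * (card \<Lambda> * r ^ 3)"
    by (simp add: power2_eq_square power3_eq_cube)
  ultimately have "2 * (card \<Lambda> * r ^ 3) \<le> 4 * (card Y)\<^sup>2 * (card S)\<^sup>2" by metis
  then show ?thesis by linarith
qed simp

section \<open>Extraction of multiplicatively controlled sets\<close>

definition reps :: "('a \<Rightarrow> 'a \<Rightarrow> 'a) \<Rightarrow> 'a set \<Rightarrow> 'a set \<Rightarrow> 'a \<Rightarrow> nat" where
  "reps f A X x = card {b \<in> X. f x b \<in> A}"

text \<open>For finite nonempty \<open>A\<close> this is d^+(A) <= d, or its multiplicative
  analogue, with denominators cleared and the sum over all x replaced by arbitrary finite partial
  sums, so that real arithmetic suffices.\<close>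

definition controlled :: "('a \<Rightarrow> 'a \<Rightarrow> 'a) \<Rightarrow> real \<Rightarrow> 'a set \<Rightarrow> bool" where
  "controlled f d A \<longleftrightarrow> (\<forall>X T. finite X \<longrightarrow> finite T \<longrightarrow>
     (\<Sum>x\<in>T. real (reps f A X x) ^ 3) \<le> d * card A * real (card X) ^ 2)"

lemma reps_le_right: "finite X \<Longrightarrow> reps f A X x \<le> card X"
  unfolding reps_def by (intro card_mono) auto

lemma reps_le_left:
  assumes "finite A" "\<And>b b'. f x b = f x b' \<Longrightarrow> b = b'"
  shows "reps f A X x \<le> card A"
  unfolding reps_def using assms
  by (intro card_inj_on_le[of "f x"]) (auto simp: inj_on_def)

lemma sum_reps_le:
  assumes "finite A" "finite X" "finite T"
    and "\<And>b x x'. b \<in> X \<Longrightarrow> f x b \<in> A \<Longrightarrow> f x b = f x' b \<Longrightarrow> x = x'"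
  shows "(\<Sum>x\<in>T. reps f A X x) \<le> card A * card X"
proof -
  have "(\<Sum>x\<in>T. reps f A X x) = card (SIGMA x:T. {b \<in> X. f x b \<in> A})"
    using assms by (simp add: reps_def)
  also have "\<dots> \<le> card (A \<times> X)"
    using assms by (intro card_inj_on_le[of "\<lambda>(x, b). (f x b, b)"]) (auto simp: inj_on_def)
  finally show ?thesis by (simp add: card_cartesian_product)
qed

text \<open>On a level 4r <= i < 8r the cubes are at most 512 r^3 and
  \<open>rich_lines_bound\<close> controls the number of lines times r^3. The product 512 * 2 = 1024
  does not depend on r, so the only loss is the number of levels.\<close>

lemma sum_rich_lines_cube_le:
  fixes Y S :: "real set"
  assumes fin: "finite Y" "finite S" "finite \<Lambda>"
    and nz: "\<And>y x. (y, x) \<in> \<Lambda> \<Longrightarrow> y \<noteq> 0"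
    and rich: "\<And>y x. (y, x) \<in> \<Lambda> \<Longrightarrow> 4 \<le> card {c \<in> Y. y * c - x \<in> S}"
    and L: "card S < 2 ^ L"
  shows "(\<Sum>(y, x)\<in>\<Lambda>. real (card {c \<in> Y. y * c - x \<in> S}) ^ 3)
    \<le> real L * (1024 * real (card Y) ^ 2 * real (card S) ^ 2)"
proof -
  define i where "i = (\<lambda>(y, x). card {c \<in> Y. y * c - x \<in> S})"
  have i4: "4 \<le> i l" if "l \<in> \<Lambda>" for l using rich that by (cases l) (auto simp: i_def)
  have "(\<Sum>l\<in>\<Lambda>. real (i l) ^ 3) \<le> real L * (1024 * real (card Y) ^ 2 * real (card S) ^ 2)"
  proof (rule dyadic_sum_le[where r = i])
    show "1 \<le> i l" if "l \<in> \<Lambda>" for l using i4[OF that] by linarith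
    show "i l < 2 ^ L" if l: "l \<in> \<Lambda>" for l
    proof (cases l)
      case (Pair y x)
      then have "y \<noteq> 0" using nz l by simp
      then have "i l \<le> card S" unfolding i_def Pair prod.case using fin
        by (intro card_inj_on_le[of "\<lambda>c. y * c - x"]) (auto simp: inj_on_def)
      then show ?thesis using L by linarith
    qed
    fix j :: nat
    let ?\<Lambda> = "{l. l \<in> \<Lambda> \<and> 2 ^ j \<le> i l \<and> i l < 2 ^ Suc j}"
    show "(\<Sum>l\<in>?\<Lambda>. real (i l) ^ 3) \<le> 1024 * real (card Y) ^ 2 * real (card S) ^ 2"
    proof (cases "?\<Lambda> = {}")
      case True
      show ?thesis unfolding True by simp
    next
      case False
      then obtain l where "l \<in> \<Lambda>" "i l < 2 ^ Suc j" by auto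
      \<comment> \<open>Richness at least 4 excludes the levels j = 0 and j = 1, so 2^j is four
        times an integer r.\<close>
      then have "(2::nat) ^ 2 < 2 ^ Suc j" using i4[of l] by simp
      then have "2 < Suc j" by (rule power_less_imp_less_exp[rotated]) simp
      then obtain k where j: "j = k + 2" by (metis Suc_leI add.commute le_Suc_ex less_Suc_eq_le)
      define r where "r = (2::nat) ^ k"
      have r: "2 ^ j = 4 * r" "2 ^ Suc j = 8 * r" "1 \<le> r" by (auto simp: j r_def power_add)
      have "card ?\<Lambda> * r ^ 3 \<le> 2 * (card Y)\<^sup>2 * (card S)\<^sup>2"
        using fin nz r by (intro rich_lines_bound) (auto simp: i_def)
      then have b: "real (card ?\<Lambda>) * real r ^ 3 \<le> 2 * real (card Y) ^ 2 * real (card S) ^ 2"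
        by (metis (mono_tags, lifting) of_nat_le_iff of_nat_mult of_nat_numeral of_nat_power)
      have "(\<Sum>l\<in>?\<Lambda>. real (i l) ^ 3) \<le> (\<Sum>l\<in>?\<Lambda>. (8 * real r) ^ 3)"
      proof (intro sum_mono power_mono)
        fix l assume "l \<in> ?\<Lambda>"
        then have "i l < 8 * r" using r by simp
        then show "real (i l) \<le> 8 * real r" by linarith
      qed simp
      also have "\<dots> = 512 * (real (card ?\<Lambda>) * real r ^ 3)" by (simp add: power_mult_distrib)
      finally show ?thesis using b by linarith
    qed
  qed (use fin in auto)
  then show ?thesis by (simp add: i_def case_prod_beta)
qed

text \<open>
  If the shifts \<open>s \<in> S\<close> represent each \<open>a \<in> A\<close> at least \<open>q\<close> times as \<open>a = s + x\<close>, then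
  every representation \<open>a = y c\<close> gives \<open>q\<close> incidences of points \<open>(c, s)\<close> with the lines
  \<open>s = y c - x\<close>.
\<close>

lemma reps_mult_cube_bound:
  fixes A S X Y :: "real set" and q L :: nat
  assumes fin: "finite A" "finite S" "finite X" "finite Y" "finite T" and A0: "0 \<notin> A"
    and q: "1 \<le> q" "\<And>a. a \<in> A \<Longrightarrow> q \<le> card {s \<in> S. a - s \<in> X}"
    and L: "card S < 2 ^ L"
  obtains \<sigma> \<mu> :: real where "(\<Sum>y\<in>T. real (reps (*) A Y y) ^ 3) = \<sigma> + \<mu>" "0 \<le> \<sigma>" "0 \<le> \<mu>"
    "q * \<sigma> \<le> 8 * real (card X) * real (card Y) ^ 2 * real (card A)"
    "real q ^ 3 * \<mu> \<le> 8192 * L * real (card X) ^ 2 * real (card Y) ^ 2 * real (card S) ^ 2"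
proof -
  let ?k = "\<lambda>y. reps (*) A Y y"
  \<comment> \<open>For these \<open>y\<close> the lines with fewer than 4 points, one for each x in
    \<open>X\<close>, carry at most 4 \<open>card X\<close> incidences, half of the total. For the
    other \<open>y\<close> a trivial bound on the cube suffices. Positivity of \<open>?k y\<close>
    gives \<open>y \<noteq> 0\<close>, also when \<open>X\<close> is empty.\<close>
  define Tl where "Tl = {y \<in> T. 8 * card X \<le> q * ?k y \<and> 0 < ?k y}"
  define Ts where "Ts = T - Tl"
  have finT: "finite Tl" "finite Ts" using fin by (auto simp: Tl_def Ts_def)
  define i where "i y x = card {c \<in> Y. y * c - x \<in> S}" for y x
  have "q * (\<Sum>y\<in>Ts. real (?k y) ^ 3) = (\<Sum>y\<in>Ts. (q * real (?k y)) * real (?k y) * real (?k y))"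
    by (simp add: sum_distrib_left power3_eq_cube ac_simps)
  also have "\<dots> \<le> (\<Sum>y\<in>Ts. (8 * real (card X)) * real (card Y) * real (?k y))"
  proof (rule sum_mono, rule mult_right_mono, rule mult_mono)
    fix y assume "y \<in> Ts"
    then have "q * ?k y \<le> 8 * card X" by (auto simp: Ts_def Tl_def)
    then show "q * real (?k y) \<le> 8 * real (card X)"
      by (metis of_nat_le_iff of_nat_mult of_nat_numeral)
    show "real (?k y) \<le> real (card Y)" using reps_le_right[OF fin(4)] by simp
  qed auto
  also have "\<dots> = (8 * real (card X) * real (card Y)) * real (\<Sum>y\<in>Ts. ?k y)"
    by (simp add: sum_distrib_left)
  also have "\<dots> \<le> (8 * real (card X) * real (card Y)) * real (card A * card Y)"
    using A0 finT fin by (intro mult_left_mono of_nat_mono sum_reps_le) auto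
  finally have small: "q * (\<Sum>y\<in>Ts. real (?k y) ^ 3)
      \<le> 8 * real (card X) * real (card Y) ^ 2 * real (card A)"
    by (simp add: power2_eq_square ac_simps)
  define Z where "Z y = {x \<in> X. 4 \<le> i y x}" for y
  have finZ: "finite (Z y)" for y using fin by (simp add: Z_def)
  have large1: "real q ^ 3 * real (?k y) ^ 3 \<le> 8 * real (card X) ^ 2 * (\<Sum>x\<in>Z y. real (i y x) ^ 3)"
    if y: "y \<in> Tl" for y
  proof -
    let ?C = "{c \<in> Y. y * c \<in> A}"
    have "q * ?k y = (\<Sum>c\<in>?C. q)" by (simp add: reps_def)
    also have "\<dots> \<le> (\<Sum>c\<in>?C. card {s \<in> S. y * c - s \<in> X})" using q by (intro sum_mono) auto
    also have "\<dots> \<le> (\<Sum>c\<in>Y. card {s \<in> S. y * c - s \<in> X})"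
      using fin by (intro sum_mono2) auto
    also have "\<dots> = card (SIGMA c:Y. {s \<in> S. y * c - s \<in> X})" using fin by simp
    also have "\<dots> \<le> card (SIGMA x:X. {c \<in> Y. y * c - x \<in> S})"
      using fin by (intro card_inj_on_le[of "\<lambda>(c, s). (y * c - s, c)"]) (auto simp: inj_on_def)
    also have "\<dots> = (\<Sum>x\<in>X. i y x)" using fin by (simp add: i_def)
    also have "\<dots> = (\<Sum>x\<in>Z y. i y x) + (\<Sum>x\<in>X - Z y. i y x)"
      using fin by (subst sum.subset_diff[of "Z y" X]) (auto simp: Z_def)
    also have "(\<Sum>x\<in>X - Z y. i y x) \<le> (\<Sum>x\<in>X - Z y. 4)" by (intro sum_mono) (auto simp: Z_def)
    also have "\<dots> \<le> 4 * card X" using fin by (auto simp: card_mono)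
    finally have "q * ?k y \<le> (\<Sum>x\<in>Z y. i y x) + 4 * card X" by simp
    then have "q * ?k y \<le> 2 * (\<Sum>x\<in>Z y. i y x)" using y unfolding Tl_def by simp
    then have "real q * ?k y \<le> 2 * (\<Sum>x\<in>Z y. real (i y x))"
      by (metis of_nat_le_iff of_nat_mult of_nat_numeral of_nat_sum)
    then have "(real q * ?k y) ^ 3 \<le> (2 * (\<Sum>x\<in>Z y. real (i y x))) ^ 3" by (intro power_mono) auto
    also have "\<dots> \<le> 8 * (real (card (Z y)) ^ 2 * (\<Sum>x\<in>Z y. real (i y x) ^ 3))"
      using sum_cube_le[of "Z y" "\<lambda>x. real (i y x)"] by (simp add: power_mult_distrib)
    also have "\<dots> \<le> 8 * (real (card X) ^ 2 * (\<Sum>x\<in>Z y. real (i y x) ^ 3))"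
      using fin by (intro mult_left_mono mult_right_mono power_mono of_nat_mono card_mono sum_nonneg)
        (auto simp: Z_def)
    finally show ?thesis by (simp add: power_mult_distrib)
  qed
  have "real q ^ 3 * (\<Sum>y\<in>Tl. real (?k y) ^ 3)
      \<le> (\<Sum>y\<in>Tl. 8 * real (card X) ^ 2 * (\<Sum>x\<in>Z y. real (i y x) ^ 3))"
    unfolding sum_distrib_left[of "real q ^ 3"] by (intro sum_mono large1)
  also have "\<dots> = 8 * real (card X) ^ 2 * (\<Sum>(y, x)\<in>Sigma Tl Z. real (i y x) ^ 3)"
    using finT finZ by (simp add: sum.Sigma sum_distrib_left[symmetric])
  also have "\<dots> \<le> 8 * real (card X) ^ 2 * (real L * (1024 * real (card Y) ^ 2 * real (card S) ^ 2))"
    unfolding i_def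
  proof (intro mult_left_mono sum_rich_lines_cube_le fin L)
    show "finite (Sigma Tl Z)" using finT finZ by auto
    fix y x assume yx: "(y, x) \<in> Sigma Tl Z"
    then show "4 \<le> card {c \<in> Y. y * c - x \<in> S}" by (auto simp: Z_def i_def)
    from yx have "0 < ?k y" by (auto simp: Tl_def)
    then have "{b \<in> Y. y * b \<in> A} \<noteq> {}" unfolding reps_def by fastforce
    then show "y \<noteq> 0" using A0 by auto
  qed auto
  finally have large: "real q ^ 3 * (\<Sum>y\<in>Tl. real (?k y) ^ 3)
      \<le> 8192 * L * real (card X) ^ 2 * real (card Y) ^ 2 * real (card S) ^ 2" by (simp add: ac_simps)
  have "(\<Sum>y\<in>T. real (?k y) ^ 3) = (\<Sum>y\<in>Ts. real (?k y) ^ 3) + (\<Sum>y\<in>Tl. real (?k y) ^ 3)"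
    unfolding Ts_def using fin by (subst sum.subset_diff[of Tl T]) (auto simp: Tl_def)
  then show ?thesis using that small large by (simp add: sum_nonneg)
qed

text \<open>
  The extraction step: if the additive cubic energy of \<open>B\<close> against some \<open>X\<close> is large, take the
  popular differences \<open>S\<close> and then the elements of \<open>B\<close> with many representations \<open>s + x\<close>.
\<close>

lemma extract_mult_controlled:
  fixes B X T :: "real set" and D :: real
  assumes fin: "finite B" "finite X" "finite T" and B0: "0 \<notin> B" and D: "1 \<le> D"
    and L: "card B ^ 3 < 2 ^ L"
    and big: "D * card B * real (card X) ^ 2 < (\<Sum>x\<in>T. real (reps (+) B X x) ^ 3)"
  obtains A where "A \<subseteq> B" "A \<noteq> {}"
    "controlled (*) (2 ^ 20 * real L ^ 5 * real (card A) ^ 2 / (D * card B)) A"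
proof -
  let ?r = "reps (+) B X"
  have rB: "?r x \<le> card B" for x using fin by (intro reps_le_left) auto
  have rX: "?r x \<le> card X" for x using fin by (intro reps_le_right)
  have pos: "0 < (\<Sum>x\<in>T. real (?r x) ^ 3)"
    by (rule le_less_trans[OF _ big]) (use D in simp)
  have "\<not> (\<forall>x. ?r x = 0)"
  proof
    assume "\<forall>x. ?r x = 0"
    then have "(\<Sum>x\<in>T. real (?r x) ^ 3) = 0" by simp
    then show False using pos by linarith
  qed
  then obtain x0 where "?r x0 \<noteq> 0" by blast
  then have ne: "0 < card B" "0 < card X" using rB[of x0] rX[of x0] by auto
  \<comment> \<open>Compared with the trivial upper bound, a large cubic energy forces
    \<open>card X < card B ^ 2\<close>. Hence \<open>card B * card X < 2 ^ L\<close>, and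
    \<open>L\<close> levels suffice for every dyadic choice below.\<close>
  have "(\<Sum>x\<in>T. real (?r x) ^ 3) \<le> (\<Sum>x\<in>T. real (card B) ^ 2 * real (?r x))"
    using rB by (intro sum_mono) (auto simp: power2_eq_square power3_eq_cube intro!: mult_mono)
  also have "\<dots> = real (card B) ^ 2 * real (\<Sum>x\<in>T. ?r x)" by (simp add: sum_distrib_left)
  also have "\<dots> \<le> real (card B) ^ 2 * real (card B * card X)"
    using fin by (intro mult_left_mono of_nat_mono sum_reps_le) auto
  finally have "D * card B * real (card X) ^ 2 < real (card B) ^ 2 * real (card B * card X)"
    using big by linarith
  then have "(real (card B) * card X) * (D * card X) < (real (card B) * card X) * (real (card B) ^ 2)"
    by (simp add: power2_eq_square ac_simps)
  then have "D * card X < real (card B) ^ 2"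
    using ne by (simp add: mult_less_cancel_left_pos)
  moreover have "1 * real (card X) \<le> D * card X" using D by (intro mult_right_mono) auto
  ultimately have "real (card X) < real (card B) ^ 2" by linarith
  then have "card X < card B ^ 2" by (metis of_nat_less_iff of_nat_power)
  then have "card B * card X \<le> card B ^ 3"
    by (simp add: power2_eq_square power3_eq_cube)
  then have BXL: "card B * card X < 2 ^ L" using L by linarith

  define T1 where "T1 = {x \<in> T. 1 \<le> ?r x}"
  have T1: "(\<Sum>x\<in>T. real (?r x) ^ 3) = (\<Sum>x\<in>T1. real (?r x) ^ 3)"
    unfolding T1_def using fin by (intro sum.mono_neutral_right) (auto simp: not_less_eq_eq)
  obtain j where j: "(\<Sum>x\<in>T1. real (?r x) ^ 3)
      \<le> real L * (\<Sum>x | x \<in> T1 \<and> 2 ^ j \<le> ?r x \<and> ?r x < 2 ^ Suc j. real (?r x) ^ 3)"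
  proof (rule dyadic_pigeonhole[of T1 ?r L "\<lambda>x. real (?r x) ^ 3"])
    show "?r x < 2 ^ L" for x
    proof -
      have "card B * 1 \<le> card B * card X" using ne by (intro mult_le_mono2) simp
      then show ?thesis using rB[of x] BXL by linarith
    qed
  qed (use fin pos T1 in \<open>auto simp: T1_def\<close>)
  define \<tau> where "\<tau> = (2::nat) ^ j"
  define S where "S = {x. x \<in> T1 \<and> 2 ^ j \<le> ?r x \<and> ?r x < 2 ^ Suc j}"
  have S: "\<tau> \<le> ?r x" "?r x < 2 * \<tau>" if "x \<in> S" for x using that by (auto simp: S_def \<tau>_def)
  have \<tau>1: "1 \<le> \<tau>" by (simp add: \<tau>_def)
  have finS: "finite S" using fin by (simp add: S_def T1_def)
  have "(\<Sum>x\<in>S. real (?r x) ^ 3) \<le> (\<Sum>x\<in>S. (2 * real \<tau>) ^ 3)"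
  proof (intro sum_mono power_mono)
    show "real (?r x) \<le> 2 * real \<tau>" if "x \<in> S" for x using S(2)[OF that] by linarith
  qed simp
  then have "real L * (\<Sum>x\<in>S. real (?r x) ^ 3) \<le> real L * (card S * (8 * real \<tau> ^ 3))"
    by (intro mult_left_mono) (auto simp: power_mult_distrib)
  then have i: "D * card B * real (card X) ^ 2 \<le> 8 * L * (real (card S) * real \<tau> ^ 3)"
    using big j T1 by (simp add: S_def)
  have "0 < D * card B * real (card X) ^ 2" using ne D by simp
  then have "8 * L * (real (card S) * real \<tau> ^ 3) \<noteq> 0" using i by linarith
  then have Sne: "S \<noteq> {}" "L \<noteq> 0" by auto
  have "(\<Sum>x\<in>S. 1) \<le> (\<Sum>x\<in>S. ?r x)" using S \<tau>1 by (intro sum_mono) (meson le_trans)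
  also have "\<dots> \<le> card B * card X" using fin finS by (intro sum_reps_le) auto
  finally have SL: "card S < 2 ^ L" using BXL by simp
  have "\<tau> \<le> card X" using Sne(1) S(1) rX by (meson all_not_in_conv le_trans)

  define q where "q b = card {s \<in> S. b - s \<in> X}" for b
  have qS: "q b \<le> card S" for b unfolding q_def using finS by (intro card_mono) auto
  have "\<tau> * card S \<le> (\<Sum>x\<in>S. ?r x)" using sum_bounded_below[of S \<tau> ?r] S by (simp add: mult.commute)
  also have "\<dots> = card (SIGMA x:S. {b \<in> X. x + b \<in> B})" using fin finS by (simp add: reps_def)
  also have "\<dots> \<le> card (SIGMA b:B. {s \<in> S. b - s \<in> X})"
    using fin finS by (intro card_inj_on_le[of "\<lambda>(x, b). (x + b, x)"]) (auto simp: inj_on_def)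
  also have "\<dots> = (\<Sum>b\<in>B. q b)" using fin finS by (simp add: q_def)
  finally have "\<tau> * card S \<le> (\<Sum>b\<in>B. q b)" .
  also have "(\<Sum>b\<in>B. q b) = (\<Sum>b | b \<in> B \<and> 1 \<le> q b. q b)"
    using fin by (intro sum.mono_neutral_right) (auto simp: not_less_eq_eq)
  finally have tot: "\<tau> * card S \<le> (\<Sum>b | b \<in> B \<and> 1 \<le> q b. q b)" .
  then have tot': "real \<tau> * card S \<le> (\<Sum>b | b \<in> B \<and> 1 \<le> q b. real (q b))"
    by (metis of_nat_le_iff of_nat_mult of_nat_sum)
  have S0: "0 < real (card S)" using Sne finS by (simp add: card_gt_0_iff)
  have \<tau>S: "0 < real \<tau> * card S" using \<tau>1 S0 by simp
  obtain k where k: "(\<Sum>b | b \<in> B \<and> 1 \<le> q b. real (q b)) \<le> real L *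
      (\<Sum>b | b \<in> {b. b \<in> B \<and> 1 \<le> q b} \<and> 2 ^ k \<le> q b \<and> q b < 2 ^ Suc k. real (q b))"
  proof (rule dyadic_pigeonhole[of "{b. b \<in> B \<and> 1 \<le> q b}" q L "\<lambda>b. real (q b)"])
    show "q b < 2 ^ L" for b using qS[of b] SL by linarith
    show "0 < (\<Sum>b | b \<in> B \<and> 1 \<le> q b. real (q b))" using \<tau>S tot' by linarith
  qed (use fin in auto)
  define A where "A = {b. b \<in> {b. b \<in> B \<and> 1 \<le> q b} \<and> 2 ^ k \<le> q b \<and> q b < 2 ^ Suc k}"
  define Q where "Q = (2::nat) ^ k"
  have A: "A \<subseteq> B" "finite A" using fin by (auto simp: A_def intro: finite_subset)
  have Q: "Q \<le> q b" "q b < 2 * Q" if "b \<in> A" for b using that by (auto simp: A_def Q_def)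
  have Q1: "1 \<le> Q" by (simp add: Q_def)
  have "(\<Sum>b\<in>A. real (q b)) \<le> (\<Sum>b\<in>A. 2 * real Q)"
  proof (intro sum_mono)
    show "real (q b) \<le> 2 * real Q" if "b \<in> A" for b using Q(2)[OF that] by linarith
  qed
  then have "real L * (\<Sum>b\<in>A. real (q b)) \<le> real L * (card A * (2 * real Q))"
    by (intro mult_left_mono) auto
  also have "\<dots> = 2 * L * (Q * real (card A))" by simp
  finally have ii: "real \<tau> * card S \<le> 2 * L * (Q * real (card A))"
    using tot' k[folded A_def] by linarith
  have "2 * L * (Q * real (card A)) \<noteq> 0" using ii \<tau>S by linarith
  then have Ane: "A \<noteq> {}" by auto
  \<comment> \<open>Cancelling \<open>card S\<close> in \<open>ii\<close> shows that the extracted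
    set has at least about \<tau> / L elements; this pays for one factor \<tau> in the small
    part.\<close>
  have "real Q \<le> card S" using Ane Q(1) qS by (meson all_not_in_conv le_trans of_nat_le_iff)
  then have "2 * L * (Q * real (card A)) \<le> 2 * L * (card S * real (card A))"
    by (intro mult_left_mono mult_right_mono) auto
  with ii have "card S * real \<tau> \<le> card S * (2 * L * real (card A))" by (simp add: ac_simps)
  then have iii: "real \<tau> \<le> 2 * L * real (card A)" using S0 by simp
  have A0: "0 < real (card A)" using Ane A by (simp add: card_gt_0_iff)

  have "controlled (*) (2 ^ 20 * real L ^ 5 * real (card A) ^ 2 / (D * card B)) A"
    unfolding controlled_def
  proof (intro allI impI)
    fix Y T' :: "real set" assume Y: "finite Y" "finite T'"
    obtain \<sigma> \<mu> :: real where
      sm: "(\<Sum>y\<in>T'. real (reps (*) A Y y) ^ 3) = \<sigma> + \<mu>" "0 \<le> \<sigma>" "0 \<le> \<mu>"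
      "Q * \<sigma> \<le> 8 * real (card X) * real (card Y) ^ 2 * real (card A)"
      "real Q ^ 3 * \<mu> \<le> 8192 * L * real (card X) ^ 2 * real (card Y) ^ 2 * real (card S) ^ 2"
    proof (rule reps_mult_cube_bound[of A S X Y T' Q L])
      show "0 \<notin> A" using A B0 by auto
      show "Q \<le> card {s \<in> S. a - s \<in> X}" if "a \<in> A" for a using Q(1)[OF that] by (simp add: q_def)
    qed (use A finS fin Y Q1 SL in auto)
    define n m s a t w l where
      "n = real (card B)" and "m = real (card X)" and "s = real (card S)" and "a = real (card A)"
      and "t = real \<tau>" and "w = real (card Y)" and "l = real L"
    have nn: "0 < n" "0 < m" "0 < s" "0 < a" "1 \<le> t" "0 \<le> w" "1 \<le> l"
      using ne S0 A0 \<tau>1 Sne(2) by (auto simp: n_def m_def s_def a_def t_def w_def l_def)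
    have i': "D * n * m^2 \<le> 8 * l * (s * t^3)" using i by (simp add: n_def m_def s_def t_def l_def)
    have ii': "t * s \<le> 2 * l * (Q * a)" using ii by (simp add: a_def s_def t_def l_def)
    have iii': "t \<le> 2 * l * a" "t \<le> m"
      using iii \<open>\<tau> \<le> card X\<close> by (simp_all add: a_def t_def m_def l_def)
    have small: "D * n * \<sigma> \<le> 256 * l^3 * w^2 * a^3"
    proof -
      have "t * s * \<sigma> \<le> 2 * l * (Q * a) * \<sigma>" using ii' sm by (intro mult_right_mono) auto
      also have "\<dots> = 2 * l * a * (Q * \<sigma>)" by simp
      also have "\<dots> \<le> 2 * l * a * (8 * m * w^2 * a)"
        using sm(4) nn by (intro mult_left_mono) (auto simp: m_def w_def a_def)
      finally have 1: "t * s * \<sigma> \<le> 16 * l * m * w^2 * a^2" by (simp add: power2_eq_square ac_simps)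
      \<comment> \<open>Two factors t are missing from the s t^3 of \<open>i'\<close>; one is
        bounded by m = \<open>card X\<close>, the other by 2 l a.\<close>
      have "(t * t) * (t * s * \<sigma>) \<le> (m * (2 * l * a)) * (16 * l * m * w^2 * a^2)"
        using 1 iii' nn sm by (intro mult_mono[of "t * t"] mult_mono[of t]) auto
      then have 2: "s * t^3 * \<sigma> \<le> 32 * l^2 * m^2 * w^2 * a^3"
        by (simp add: power2_eq_square power3_eq_cube ac_simps)
      have "m^2 * (D * n * \<sigma>) = (D * n * m^2) * \<sigma>" by simp
      also have "\<dots> \<le> 8 * l * (s * t^3) * \<sigma>" using i' sm by (intro mult_right_mono) auto
      also have "\<dots> = 8 * l * (s * t^3 * \<sigma>)" by simp
      also have "\<dots> \<le> 8 * l * (32 * l^2 * m^2 * w^2 * a^3)" using 2 nn by (intro mult_left_mono) auto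
      also have "\<dots> = m^2 * (256 * l^3 * w^2 * a^3)" by (simp add: power2_eq_square power3_eq_cube)
      finally show ?thesis using nn by (simp add: mult_le_cancel_left_pos)
    qed
    have large: "D * n * \<mu> \<le> 524288 * l^5 * w^2 * a^3"
    proof -
      \<comment> \<open>Cubing \<open>ii'\<close> produces the factor \<open>Q ^ 3\<close> required
        by the bound for \<mu>; after cancellation of s^2 exactly the s t^3 of \<open>i'\<close> is
        left.\<close>
      have "(t * s)^3 * \<mu> \<le> (2 * l * (Q * a))^3 * \<mu>"
        using ii' sm nn by (intro mult_right_mono power_mono) auto
      also have "\<dots> = 8 * l^3 * a^3 * (real Q ^ 3 * \<mu>)" by (simp add: power_mult_distrib)
      also have "\<dots> \<le> 8 * l^3 * a^3 * (8192 * l * m^2 * w^2 * s^2)"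
        using sm(5) nn by (intro mult_left_mono) (auto simp: m_def w_def s_def l_def)
      finally have "s^2 * (s * t^3 * \<mu>) \<le> s^2 * (65536 * l^4 * a^3 * m^2 * w^2)"
        by (simp add: power2_eq_square power3_eq_cube power4_eq_xxxx ac_simps)
      then have 2: "s * t^3 * \<mu> \<le> 65536 * l^4 * a^3 * m^2 * w^2"
        using nn by (simp add: mult_le_cancel_left_pos)
      have "m^2 * (D * n * \<mu>) = (D * n * m^2) * \<mu>" by simp
      also have "\<dots> \<le> 8 * l * (s * t^3) * \<mu>" using i' sm by (intro mult_right_mono) auto
      also have "\<dots> = 8 * l * (s * t^3 * \<mu>)" by simp
      also have "\<dots> \<le> 8 * l * (65536 * l^4 * a^3 * m^2 * w^2)" using 2 nn by (intro mult_left_mono) auto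
      also have "\<dots> = m^2 * (524288 * l^5 * w^2 * a^3)" by (simp add: power_numeral_reduce)
      finally show ?thesis using nn by (simp add: mult_le_cancel_left_pos)
    qed
    have "l^3 \<le> l^5" using nn by (intro power_increasing) auto
    then have "256 * l^3 * w^2 * a^3 \<le> 256 * l^5 * w^2 * a^3"
      using nn by (intro mult_right_mono mult_left_mono) auto
    moreover have "0 \<le> l^5 * w^2 * a^3" using nn by simp
    \<comment> \<open>The constant 2^20 absorbs 256 + 2^19.\<close>
    ultimately have "D * n * (\<sigma> + \<mu>) \<le> 2 ^ 20 * l^5 * w^2 * a^3"
      using small large by (simp add: algebra_simps)
    then have "\<sigma> + \<mu> \<le> 2 ^ 20 * l^5 * w^2 * a^3 / (D * n)"
      using nn D by (simp add: pos_le_divide_eq mult.commute)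
    also have "\<dots> = 2 ^ 20 * l ^ 5 * a ^ 2 / (D * n) * a * w ^ 2"
      by (simp add: power2_eq_square power3_eq_cube)
    finally show "(\<Sum>y\<in>T'. real (reps (*) A Y y) ^ 3)
        \<le> 2 ^ 20 * real L ^ 5 * real (card A) ^ 2 / (D * card B) * card A * real (card Y) ^ 2"
      by (simp only: sm(1) l_def a_def n_def w_def)
  qed
  then show ?thesis using that A Ane by blast
qed

section \<open>The partition\<close>

lemma reps_Un_le:
  assumes "finite X"
  shows "reps f (A \<union> B) X x \<le> reps f A X x + reps f B X x"
proof -
  have "{b \<in> X. f x b \<in> A \<union> B} = {b \<in> X. f x b \<in> A} \<union> {b \<in> X. f x b \<in> B}" by auto
  then show ?thesis unfolding reps_def by (simp only: card_Un_le)
qed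

lemma Minkowski_reps:
  assumes fin: "finite X" "finite T"
    and "(\<Sum>x\<in>T. real (reps f A X x) ^ 3) \<le> u ^ 3" "(\<Sum>x\<in>T. real (reps f B X x) ^ 3) \<le> v ^ 3"
    and "0 \<le> u" "0 \<le> v"
  shows "(\<Sum>x\<in>T. real (reps f (A \<union> B) X x) ^ 3) \<le> (u + v) ^ 3"
proof -
  have "(\<Sum>x\<in>T. real (reps f (A \<union> B) X x) ^ 3)
      \<le> (\<Sum>x\<in>T. (real (reps f A X x) + real (reps f B X x)) ^ 3)"
    using reps_Un_le[OF fin(1)] by (intro sum_mono power_mono) (auto simp flip: of_nat_add)
  also have "\<dots> \<le> (u + v) ^ 3"
    using assms by (intro Minkowski_cube) auto
  finally show ?thesis .
qed

text \<open>For g <= b, the right-hand side is the integral of x^(-1/3) from g^3 to b^3, and 1/b is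
  the least value of that decreasing integrand.\<close>

lemma cube_telescoping_step:
  fixes b g :: real
  assumes "0 < b" "0 \<le> g"
  shows "(b ^ 3 - g ^ 3) / b \<le> 3 / 2 * (b\<^sup>2 - g\<^sup>2)"
proof -
  have "3 / 2 * (b\<^sup>2 - g\<^sup>2) * b - (b ^ 3 - g ^ 3) = (b - g)\<^sup>2 * (b + 2 * g) / 2"
    by (simp add: power2_eq_square power3_eq_cube field_simps)
  also have "\<dots> \<ge> 0" using assms by simp
  finally show ?thesis using assms by (simp add: pos_divide_le_eq)
qed

text \<open>Subadditivity of t^(2/3), cleared of roots. It turns the telescoped total into a power
  of the size of the union of the pieces.\<close>

lemma square_diff_cube_le:
  fixes b g :: real
  assumes "0 \<le> g" "g \<le> b"
  shows "(b\<^sup>2 - g\<^sup>2) ^ 3 \<le> (b ^ 3 - g ^ 3)\<^sup>2"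
proof -
  have "(b ^ 3 - g ^ 3)\<^sup>2 - (b\<^sup>2 - g\<^sup>2) ^ 3 = g\<^sup>2 * (b - g)\<^sup>2 * (3 * b\<^sup>2 + 4 * b * g + 2 * g\<^sup>2)"
    by (simp add: power2_eq_square power3_eq_cube algebra_simps)
  also have "\<dots> \<ge> 0" using assms by simp
  finally show ?thesis by simp
qed

text \<open>
  Pieces are extracted until the rest \<open>B\<^sub>1\<close> is controlled. Piece \<open>A\<close>, cut from a set of size
  \<open>b\<close>, contributes \<open>card A / b powr (1/3)\<close> to the \<open>\<ell>\<^sup>3\<close> norm of the representation function,
  and these contributions telescope against \<open>3/2 * b powr (2/3)\<close>, so no factor is lost in the
  number of steps.
\<close>

lemma partition_aux:
  fixes B :: "real set" and D :: real
  assumes "finite B" "0 \<notin> B" "1 \<le> D" "card B ^ 3 < 2 ^ L"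
  shows "\<exists>B1 C. B1 \<union> C = B \<and> B1 \<inter> C = {} \<and> controlled (+) D B1 \<and>
    (\<forall>Y T. finite Y \<longrightarrow> finite T \<longrightarrow> (\<Sum>y\<in>T. real (reps (*) C Y y) ^ 3)
      \<le> 2 ^ 20 * real L ^ 5 / D * real (card Y) ^ 2
         * (3 / 2 * ((root 3 (card B))\<^sup>2 - (root 3 (card B1))\<^sup>2)) ^ 3)"
  using assms
proof (induction "card B" arbitrary: B rule: less_induct)
  case less
  note fin = less.prems(1)
  let ?M = "2 ^ 20 * real L ^ 5 / D"
  show ?case
  proof (cases "controlled (+) D B")
    case True
    then show ?thesis by (intro exI[of _ B] exI[of _ "{}"]) (simp add: reps_def)
  next
    case False
    then obtain X T where "finite X" "finite T"
      "D * card B * real (card X) ^ 2 < (\<Sum>x\<in>T. real (reps (+) B X x) ^ 3)"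
      unfolding controlled_def by (auto simp: not_le)
    from extract_mult_controlled[OF fin this(1,2) less.prems(2-4) this(3)]
    obtain A where A: "A \<subseteq> B" "A \<noteq> {}"
      and cA: "controlled (*) (2 ^ 20 * real L ^ 5 * real (card A) ^ 2 / (D * card B)) A" .
    have finA: "finite A" using A fin finite_subset by blast
    have A0: "0 < card A" using A finA by (simp add: card_gt_0_iff)
    have cBA: "card (B - A) = card B - card A" "card A \<le> card B"
      using A fin finA by (simp_all add: card_Diff_subset card_mono)
    then have lt: "card (B - A) < card B" using A0 by linarith
    then have "card (B - A) ^ 3 < 2 ^ L"
      using less.prems(4) power_mono[of "card (B - A)" "card B" 3] by linarith
    from less.hyps[OF lt _ _ less.prems(3) this] fin less.prems(2)
    obtain B1 C where BC: "B1 \<union> C = B - A" "B1 \<inter> C = {}" "controlled (+) D B1"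
      and C: "\<And>Y T. finite Y \<Longrightarrow> finite T \<Longrightarrow> (\<Sum>y\<in>T. real (reps (*) C Y y) ^ 3)
        \<le> ?M * real (card Y) ^ 2
         * (3 / 2 * ((root 3 (card (B - A)))\<^sup>2 - (root 3 (card B1))\<^sup>2)) ^ 3"
      by (metis DiffD1 finite_Diff)
    define b g g1 where "b = root 3 (card B)" and "g = root 3 (card (B - A))"
      and "g1 = root 3 (card B1)"
    have cube: "b ^ 3 = card B" "g ^ 3 = card (B - A)" by (simp_all add: b_def g_def)
    have b0: "0 < b" using lt by (simp add: b_def)
    have g10: "0 \<le> g1" by (simp add: g1_def)
    have "card B1 \<le> card (B - A)" using BC fin by (intro card_mono) auto
    then have "g1 \<le> g" by (simp add: g_def g1_def)
    then have g1g: "g1\<^sup>2 \<le> g\<^sup>2" using g10 by (intro power_mono)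
    have a: "real (card A) = b ^ 3 - g ^ 3" using cube cBA by simp
    have step: "real (card A) / b \<le> 3 / 2 * (b\<^sup>2 - g\<^sup>2)"
      unfolding a by (rule cube_telescoping_step) (use b0 in \<open>simp_all add: g_def\<close>)
    show ?thesis
    proof (rule exI[of _ B1], rule exI[of _ "A \<union> C"], intro conjI allI impI)
      fix Y T :: "real set" assume YT: "finite Y" "finite T"
      \<comment> \<open>The cube root of the common factor brings both bounds into the form
        \<open>u ^ 3\<close> of Minkowski's inequality; for the piece \<open>A\<close> this uses b^3
        = \<open>card B\<close>.\<close>
      define K where "K = root 3 (?M * real (card Y) ^ 2)"
      have M0: "0 \<le> ?M * real (card Y) ^ 2" using less.prems(3) by simp
      have K: "K ^ 3 = ?M * real (card Y) ^ 2" "0 \<le> K"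
        unfolding K_def using M0 by (rule real_root_pow_pos2[OF zero_less_numeral],
          rule real_root_ge_zero)
      have 1: "(\<Sum>y\<in>T. real (reps (*) A Y y) ^ 3) \<le> (K * (card A / b)) ^ 3"
      proof -
        have "(\<Sum>y\<in>T. real (reps (*) A Y y) ^ 3)
            \<le> 2 ^ 20 * real L ^ 5 * real (card A) ^ 2 / (D * card B) * card A * real (card Y) ^ 2"
          using cA YT unfolding controlled_def by blast
        also have "\<dots> = (K * (card A / b)) ^ 3"
          unfolding power_mult_distrib K(1) power_divide cube(1)
          by (simp add: power2_eq_square power3_eq_cube)
        finally show ?thesis .
      qed
      have 2: "(\<Sum>y\<in>T. real (reps (*) C Y y) ^ 3) \<le> (K * (3 / 2 * (g\<^sup>2 - g1\<^sup>2))) ^ 3"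
        using C[OF YT] unfolding power_mult_distrib K(1) g_def g1_def by (simp add: power_mult_distrib)
      have "(\<Sum>y\<in>T. real (reps (*) (A \<union> C) Y y) ^ 3)
          \<le> (K * (card A / b) + K * (3 / 2 * (g\<^sup>2 - g1\<^sup>2))) ^ 3"
        using 1 2 YT K(2) b0 g1g by (intro Minkowski_reps) auto
      also have "\<dots> = (K * (card A / b + 3 / 2 * (g\<^sup>2 - g1\<^sup>2))) ^ 3" by (simp add: distrib_left)
      also have "\<dots> \<le> (K * (3 / 2 * (b\<^sup>2 - g1\<^sup>2))) ^ 3"
      proof (rule power_mono)
        have "card A / b + 3 / 2 * (g\<^sup>2 - g1\<^sup>2) \<le> 3 / 2 * (b\<^sup>2 - g1\<^sup>2)"
        proof -
          have "x + 3 / 2 * (q - r) \<le> 3 / 2 * (p - r)" if "x \<le> 3 / 2 * (p - q)" for x p q r :: real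
            using that by (simp add: right_diff_distrib)
          then show ?thesis using step .
        qed
        then show "K * (card A / b + 3 / 2 * (g\<^sup>2 - g1\<^sup>2)) \<le> K * (3 / 2 * (b\<^sup>2 - g1\<^sup>2))"
          using K(2) by (rule mult_left_mono)
        show "0 \<le> K * (card A / b + 3 / 2 * (g\<^sup>2 - g1\<^sup>2))"
          using K(2) b0 g1g by (intro mult_nonneg_nonneg add_nonneg_nonneg) auto
      qed
      also have "\<dots> = ?M * real (card Y) ^ 2 * (3 / 2 * (b\<^sup>2 - g1\<^sup>2)) ^ 3"
        by (subst power_mult_distrib) (simp only: K(1))
      finally show "(\<Sum>y\<in>T. real (reps (*) (A \<union> C) Y y) ^ 3) \<le> ?M * real (card Y) ^ 2
         * (3 / 2 * ((root 3 (card B))\<^sup>2 - (root 3 (card B1))\<^sup>2)) ^ 3"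
        by (simp only: b_def g1_def)
    qed (use BC A in auto)
  qed
qed

lemma exists_controlled_partition:
  fixes B :: "real set" and D :: real
  assumes fin: "finite B" and B0: "0 \<notin> B" and D: "1 \<le> D" and L: "card B ^ 3 < 2 ^ L"
  obtains B1 C where "B1 \<union> C = B" "B1 \<inter> C = {}" "controlled (+) D B1"
    "controlled (*) (2 ^ 22 * real L ^ 5 / D * card B) C"
proof -
  let ?M = "2 ^ 20 * real L ^ 5 / D"
  obtain B1 C where BC: "B1 \<union> C = B" "B1 \<inter> C = {}" "controlled (+) D B1"
    and C: "\<And>Y T. finite Y \<Longrightarrow> finite T \<Longrightarrow> (\<Sum>y\<in>T. real (reps (*) C Y y) ^ 3)
        \<le> ?M * real (card Y) ^ 2
         * (3 / 2 * ((root 3 (card B))\<^sup>2 - (root 3 (card B1))\<^sup>2)) ^ 3"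
    using partition_aux[OF assms] by blast
  have "finite B1" "finite C" using BC fin by auto
  then have card: "card B = card B1 + card C" using BC card_Un_disjoint by blast
  define b g where "b = root 3 (card B)" and "g = root 3 (card B1)"
  have cube: "b ^ 3 = card B" "g ^ 3 = card B1" by (simp_all add: b_def g_def)
  have bg: "0 \<le> g" "g \<le> b" using card by (simp_all add: b_def g_def)
  have "controlled (*) (2 ^ 22 * real L ^ 5 / D * card B) C"
    unfolding controlled_def
  proof (intro allI impI)
    fix Y T :: "real set" assume YT: "finite Y" "finite T"
    have "(b\<^sup>2 - g\<^sup>2) ^ 3 \<le> (real (card C))\<^sup>2"
      using square_diff_cube_le[OF bg] card unfolding cube by simp
    also have "\<dots> \<le> card B * card C" using card by (simp add: power2_eq_square mult_right_mono)
    finally have w: "(b\<^sup>2 - g\<^sup>2) ^ 3 \<le> real (card B) * real (card C)" by simp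
    have "(\<Sum>y\<in>T. real (reps (*) C Y y) ^ 3)
        \<le> ?M * real (card Y) ^ 2 * (3 / 2 * (b\<^sup>2 - g\<^sup>2)) ^ 3"
      using C[OF YT] by (simp add: b_def g_def)
    also have "\<dots> = ?M * real (card Y) ^ 2 * (27 / 8 * (b\<^sup>2 - g\<^sup>2) ^ 3)"
      by (subst power_mult_distrib) (simp add: power_divide)
    \<comment> \<open>Rounding 27/8 up to 4 turns 2^20 into 2^22.\<close>
    also have "\<dots> \<le> ?M * real (card Y) ^ 2 * (4 * (real (card B) * real (card C)))"
    proof (rule mult_left_mono)
      have "0 \<le> real (card B) * real (card C)" by simp
      then show "27 / 8 * (b\<^sup>2 - g\<^sup>2) ^ 3 \<le> 4 * (real (card B) * real (card C))"
        using w by linarith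
    qed (use D in simp)
    finally show "(\<Sum>y\<in>T. real (reps (*) C Y y) ^ 3)
        \<le> 2 ^ 22 * real L ^ 5 / D * card B * card C * real (card Y) ^ 2"
      by (simp add: ac_simps)
  qed
  with BC that show ?thesis by blast
qed

text \<open>Allows 0 to join the additive part at the end. A single point has representation numbers
  0 or 1, so their cubes sum to at most \<open>card X\<close>, and (s + t)^3 <= 4 (s^3 + t^3)
  accounts for the factor 4.\<close>

lemma controlled_insert:
  fixes B :: "'a::ab_group_add set"
  assumes "finite B" "z \<notin> B" "controlled (+) d B" "1 \<le> d"
  shows "controlled (+) (4 * d) (insert z B)"
  unfolding controlled_def
proof (intro allI impI)
  fix X T :: "'a set" assume XT: "finite X" "finite T"
  have one: "reps (+) {z} X x \<le> 1" for x
    using reps_le_left[of "{z}" "(+)" x X] by simp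
  have two: "reps (+) (insert z B) X x \<le> reps (+) B X x + reps (+) {z} X x" for x
    using reps_Un_le[OF XT(1), of "(+)" B "{z}" x] by simp
  have cube: "(s + t) ^ 3 \<le> 4 * (s ^ 3 + t ^ 3)" if "0 \<le> s" "0 \<le> t" for s t :: real
  proof -
    have "4 * (s ^ 3 + t ^ 3) - (s + t) ^ 3 = 3 * (s + t) * (s - t)\<^sup>2"
      by (simp add: power2_eq_square power3_eq_cube algebra_simps)
    moreover have "0 \<le> 3 * (s + t) * (s - t)\<^sup>2" using that by simp
    ultimately show ?thesis by linarith
  qed
  have "(\<Sum>x\<in>T. real (reps (+) (insert z B) X x) ^ 3)
      \<le> (\<Sum>x\<in>T. 4 * (real (reps (+) B X x) ^ 3 + real (reps (+) {z} X x)))"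
  proof (rule sum_mono)
    fix x
    have "real (reps (+) (insert z B) X x) ^ 3 \<le> (real (reps (+) B X x) + real (reps (+) {z} X x)) ^ 3"
      using two[of x] by (intro power_mono) auto
    also have "\<dots> \<le> 4 * (real (reps (+) B X x) ^ 3 + real (reps (+) {z} X x) ^ 3)"
      by (rule cube) auto
    also have "real (reps (+) {z} X x) ^ 3 = real (reps (+) {z} X x)"
      using one[of x] by (cases "reps (+) {z} X x") auto
    finally show "real (reps (+) (insert z B) X x) ^ 3
      \<le> 4 * (real (reps (+) B X x) ^ 3 + real (reps (+) {z} X x))" .
  qed
  also have "\<dots> = 4 * ((\<Sum>x\<in>T. real (reps (+) B X x) ^ 3) + real (\<Sum>x\<in>T. reps (+) {z} X x))"
    by (simp add: sum_distrib_left sum.distrib distrib_left)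
  also have "\<dots> \<le> 4 * (d * card B * real (card X) ^ 2 + d * real (card X) ^ 2)"
  proof (intro mult_left_mono add_mono)
    show "(\<Sum>x\<in>T. real (reps (+) B X x) ^ 3) \<le> d * card B * real (card X) ^ 2"
      using assms(3) XT unfolding controlled_def by blast
    have "(\<Sum>x\<in>T. reps (+) {z} X x) \<le> card {z} * card X"
      using XT by (intro sum_reps_le) auto
    also have "\<dots> \<le> card X ^ 2" by (simp add: power2_nat_le_imp_le power2_eq_square)
    finally have "real (\<Sum>x\<in>T. reps (+) {z} X x) \<le> 1 * real (card X) ^ 2"
      by (metis mult_1 of_nat_le_iff of_nat_power)
    also have "\<dots> \<le> d * real (card X) ^ 2" using assms(4) by (intro mult_right_mono) auto
    finally show "real (\<Sum>x\<in>T. reps (+) {z} X x) \<le> d * real (card X) ^ 2" .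
  qed auto
  also have "\<dots> = 4 * d * card (insert z B) * real (card X) ^ 2"
    using assms by (simp add: algebra_simps)
  finally show "(\<Sum>x\<in>T. real (reps (+) (insert z B) X x) ^ 3)
      \<le> 4 * d * card (insert z B) * real (card X) ^ 2" .
qed

section \<open>The energy of controlled sets\<close>

text \<open>Cauchy--Schwarz for r^2 = r^(1/2) * r^(3/2), with the sum of r at most
  \<open>card A * card X\<close>.\<close>

lemma controlled_energy:
  assumes fin: "finite A" "finite X" "finite T" and c: "controlled f d A"
    and inj: "\<And>b x x'. b \<in> X \<Longrightarrow> f x b \<in> A \<Longrightarrow> f x b = f x' b \<Longrightarrow> x = x'"
  shows "(\<Sum>x\<in>T. real (reps f A X x) ^ 2)\<^sup>2 \<le> d * real (card A) ^ 2 * real (card X) ^ 3"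
proof -
  let ?r = "\<lambda>x. real (reps f A X x)"
  have s: "sqrt (?r x) * sqrt (?r x) = ?r x" for x by simp
  have s3: "(sqrt (?r x) * ?r x)\<^sup>2 = ?r x ^ 3" for x
    by (simp add: power_mult_distrib) (simp add: power2_eq_square power3_eq_cube)
  have "(\<Sum>x\<in>T. ?r x ^ 2)\<^sup>2 = (\<Sum>x\<in>T. sqrt (?r x) * (sqrt (?r x) * ?r x))\<^sup>2"
    by (simp add: mult.assoc[symmetric] s power2_eq_square del: mult.assoc)
  also have "\<dots> \<le> (\<Sum>x\<in>T. (sqrt (?r x))\<^sup>2) * (\<Sum>x\<in>T. (sqrt (?r x) * ?r x)\<^sup>2)"
    by (rule Cauchy_Schwarz_ineq_sum)
  also have "\<dots> = real (\<Sum>x\<in>T. reps f A X x) * (\<Sum>x\<in>T. ?r x ^ 3)"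
    unfolding s3 by simp
  also have "\<dots> \<le> real (card A * card X) * (d * card A * real (card X) ^ 2)"
  proof (rule mult_mono)
    show "real (\<Sum>x\<in>T. reps f A X x) \<le> real (card A * card X)"
      using fin inj by (intro of_nat_mono sum_reps_le)
    show "(\<Sum>x\<in>T. ?r x ^ 3) \<le> d * card A * real (card X) ^ 2"
      using c fin unfolding controlled_def by blast
  qed (auto intro: sum_nonneg)
  also have "\<dots> = d * real (card A) ^ 2 * real (card X) ^ 3"
    by (simp add: power2_eq_square power3_eq_cube)
  finally show ?thesis .
qed

section \<open>Popular differences and forks in an abelian group\<close>

context
  fixes A :: "'a::ab_group_add set" and d :: real and r :: "'a \<Rightarrow> nat" and \<Delta> :: "'a set" and E :: real
  assumes finA: "finite A" and contr: "controlled (+) d A"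
  defines "r \<equiv> reps (+) A A"
    and "\<Delta> \<equiv> (\<lambda>(a, b). a - b) ` (A \<times> A)"
    and "E \<equiv> \<Sum>s\<in>(\<lambda>(a, b). a - b) ` (A \<times> A). real (reps (+) A A s) ^ 2"
begin

lemma energy_eq: "E = (\<Sum>s\<in>\<Delta>. real (r s) ^ 2)"
  by (simp add: E_def r_def \<Delta>_def)

lemma finite_differences: "finite \<Delta>" using finA by (simp add: \<Delta>_def)

lemma differences_mem: "a \<in> A \<Longrightarrow> b \<in> A \<Longrightarrow> a - b \<in> \<Delta>" by (auto simp: \<Delta>_def)

lemma differences_memI: "s \<in> \<Delta>" if "r s \<noteq> 0"
proof -
  from that have "{b \<in> A. s + b \<in> A} \<noteq> {}" unfolding r_def reps_def by fastforce
  then obtain b where "b \<in> A" "s + b \<in> A" by blast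
  then show ?thesis using differences_mem[of "s + b" b] by simp
qed

lemma sum_reps_cube_le: "(\<Sum>s\<in>T. real (r s) ^ 3) \<le> d * real (card A) ^ 3" if "finite T"
proof -
  have "(\<Sum>s\<in>T. real (r s) ^ 3) \<le> d * card A * real (card A) ^ 2"
    using contr that finA unfolding controlled_def r_def by blast
  then show ?thesis by (simp add: power2_eq_square power3_eq_cube mult.assoc)
qed

text \<open>
  \<open>fork P\<close> is the sum of \<open>r (y - z)\<close> over \<open>x, y, z \<in> A\<close> with \<open>x - y, x - z \<in> P\<close>: the
  representations \<open>y - z = b - b'\<close> correspond to the shifts \<open>t\<close> with \<open>b = t + y\<close>, \<open>b' = t + z\<close>.
\<close>

definition fork :: "'a set \<Rightarrow> real" where
  "fork P = (\<Sum>(t, x)\<in>\<Delta> \<times> A. real (card {y \<in> A. t + y \<in> A \<and> x - y \<in> P}) ^ 2)"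

text \<open>
  Cauchy--Schwarz against the weight \<open>r t\<close>. The resulting sum \<open>G\<close> equals \<open>\<Sum>y\<in>A. deg y * h y\<close>
  with \<open>h y = (\<Sum>x\<in>A. r (x - y)) \<ge> \<tau> * deg y\<close>, so no regularity of the degrees is needed.
\<close>

lemma fork_lower:
  assumes P: "P \<subseteq> \<Delta>" "\<And>s. s \<in> P \<Longrightarrow> \<tau> \<le> r s"
  shows "real \<tau> ^ 2 * real (\<Sum>s\<in>P. r s) ^ 4 \<le> real (card A) ^ 3 * fork P * E"
proof -
  define e where "e = (\<Sum>s\<in>P. r s)"
  define deg where "deg y = card {x \<in> A. x - y \<in> P}" for y
  define g where "g = (\<lambda>(t, x). card {y \<in> A. t + y \<in> A \<and> x - y \<in> P})"
  have finP: "finite P" using P finite_differences finite_subset by blast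
  \<comment> \<open>The number of edges x - y in \<open>P\<close> of a directed graph on
    \<open>A\<close>, first by difference and then by the endpoint y.\<close>
  have "e = card (SIGMA s:P. {b \<in> A. s + b \<in> A})" using finP finA by (simp add: e_def r_def reps_def)
  also have "\<dots> = card (SIGMA y:A. {x \<in> A. x - y \<in> P})"
    by (rule bij_betw_same_card[of "\<lambda>(s, b). (b, s + b)"],
        rule bij_betw_byWitness[where f' = "\<lambda>(y, x). (x - y, y)"]) auto
  also have "\<dots> = (\<Sum>y\<in>A. deg y)" using finA by (simp add: deg_def)
  finally have e: "e = (\<Sum>y\<in>A. deg y)" .
  define G where "G = (\<Sum>l\<in>\<Delta>\<times>A. real (g l) * real (r (fst l)))"
  have "(\<Sum>l\<in>\<Delta>\<times>A. g l * r (fst l)) = (\<Sum>t\<in>\<Delta>. \<Sum>x\<in>A. g (t, x) * r t)"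
    by (simp add: sum.cartesian_product case_prod_beta)
  also have "\<dots> = (\<Sum>t\<in>\<Delta>. r t * (\<Sum>x\<in>A. g (t, x)))"
    by (simp add: sum_distrib_left mult.commute)
  also have "\<dots> = (\<Sum>t\<in>\<Delta>. r t * (\<Sum>y | y \<in> A \<and> t + y \<in> A. deg y))"
  proof (rule sum.cong[OF refl], rule arg_cong2[where f = "(*)", OF refl])
    fix t
    have "(\<Sum>x\<in>A. g (t, x)) = card (SIGMA x:A. {y \<in> A. t + y \<in> A \<and> x - y \<in> P})"
      using finA by (simp add: g_def)
    also have "\<dots> = card (SIGMA y:{y \<in> A. t + y \<in> A}. {x \<in> A. x - y \<in> P})"
      by (rule bij_betw_same_card[of prod.swap], rule bij_betw_byWitness[where f' = prod.swap]) auto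
    also have "\<dots> = (\<Sum>y | y \<in> A \<and> t + y \<in> A. deg y)" using finA by (simp add: deg_def)
    finally show "(\<Sum>x\<in>A. g (t, x)) = (\<Sum>y | y \<in> A \<and> t + y \<in> A. deg y)" .
  qed
  also have "\<dots> = (\<Sum>t\<in>\<Delta>. \<Sum>y | y \<in> A \<and> t + y \<in> A. deg y * r t)"
    by (simp add: sum_distrib_left mult.commute)
  also have "\<dots> = (\<Sum>y\<in>A. \<Sum>t | t \<in> \<Delta> \<and> t + y \<in> A. deg y * r t)"
    using finite_differences finA by (rule sum.swap_restrict)
  also have "\<dots> \<ge> (\<Sum>y\<in>A. \<tau> * (deg y * deg y))"
  proof (rule sum_mono)
    fix y assume y: "y \<in> A"
    have "(\<Sum>x | x \<in> A \<and> x - y \<in> P. \<tau>) \<le> (\<Sum>x | x \<in> A \<and> x - y \<in> P. r (x - y))"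
      using P by (intro sum_mono) auto
    also have "\<dots> \<le> (\<Sum>x\<in>A. r (x - y))" using finA by (intro sum_mono2) auto
    also have "\<dots> = (\<Sum>t | t \<in> \<Delta> \<and> t + y \<in> A. r t)"
      by (rule sum.reindex_bij_witness[of _ "\<lambda>t. t + y" "\<lambda>x. x - y"]) (use y differences_mem in auto)
    finally have "\<tau> * deg y \<le> (\<Sum>t | t \<in> \<Delta> \<and> t + y \<in> A. r t)"
      by (simp add: deg_def mult.commute)
    then have "deg y * (\<tau> * deg y) \<le> deg y * (\<Sum>t | t \<in> \<Delta> \<and> t + y \<in> A. r t)" by simp
    then show "\<tau> * (deg y * deg y) \<le> (\<Sum>t | t \<in> \<Delta> \<and> t + y \<in> A. deg y * r t)"
      by (simp add: sum_distrib_left ac_simps)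
  qed
  finally have "real (\<Sum>y\<in>A. \<tau> * (deg y * deg y)) \<le> real (\<Sum>l\<in>\<Delta>\<times>A. g l * r (fst l))"
    by (rule of_nat_mono)
  then have G1: "\<tau> * (\<Sum>y\<in>A. (real (deg y))\<^sup>2) \<le> G"
    by (simp add: G_def sum_distrib_left power2_eq_square)
  have "(real e)\<^sup>2 \<le> card A * (\<Sum>y\<in>A. (real (deg y))\<^sup>2)"
    using sum_sq_le[of "\<lambda>y. real (deg y)" A] by (simp add: e)
  then have "\<tau> * (real e)\<^sup>2 \<le> \<tau> * (card A * (\<Sum>y\<in>A. (real (deg y))\<^sup>2))"
    by (intro mult_left_mono) auto
  also have "\<dots> \<le> card A * G"
    using mult_left_mono[OF G1, of "card A"] by (simp add: ac_simps)
  finally have "(\<tau> * (real e)\<^sup>2)\<^sup>2 \<le> (card A * G)\<^sup>2" by (intro power_mono) auto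
  also have "\<dots> = real (card A) ^ 2 * G\<^sup>2" by (simp add: power_mult_distrib)
  also have "\<dots> \<le> real (card A) ^ 2 * (fork P * (card A * E))"
  proof (rule mult_left_mono)
    have "G\<^sup>2 \<le> (\<Sum>l\<in>\<Delta>\<times>A. (real (g l))\<^sup>2) * (\<Sum>l\<in>\<Delta>\<times>A. (real (r (fst l)))\<^sup>2)"
      unfolding G_def by (rule Cauchy_Schwarz_ineq_sum)
    also have "(\<Sum>l\<in>\<Delta>\<times>A. (real (g l))\<^sup>2) = fork P"
      unfolding fork_def g_def by (intro sum.cong) auto
    also have "(\<Sum>l\<in>\<Delta>\<times>A. (real (r (fst l)))\<^sup>2) = (\<Sum>t\<in>\<Delta>. \<Sum>x\<in>A. (real (r t))\<^sup>2)"
      unfolding sum.cartesian_product by (simp add: case_prod_beta)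
    also have "\<dots> = card A * E" by (simp add: energy_eq sum_distrib_left)
    finally show "G\<^sup>2 \<le> fork P * (card A * E)" .
  qed simp
  also have "(\<tau> * (real e)\<^sup>2)\<^sup>2 = real \<tau> ^ 2 * real e ^ 4"
    by (simp add: power_mult_distrib flip: power_mult)
  finally show ?thesis by (simp add: e_def power2_eq_square power3_eq_cube ac_simps)
qed

text \<open>A fork is encoded by p = x - y, p' = x - y', the vertex x and b = t + y'; since p' - p =
  y - y', b represents p' - p. Cauchy--Schwarz separates the vertices from the representations. Two
  vertices x, x' for the same p, p' give three representations of x - x', based at x', x' - p and x'
  - p', so the first factor is at most the cubic energy.\<close>

lemma fork_upper:
  assumes P: "P \<subseteq> \<Delta>"
  shows "(fork P)\<^sup>2 \<le> d * real (card A) ^ 3 * (\<Sum>(p, p')\<in>P \<times> P. real (r (p' - p)) ^ 2)"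
proof -
  have finP: "finite P" using P finite_differences finite_subset by blast
  define C where "C = (\<lambda>(p, p'). {x \<in> A. x - p \<in> A \<and> x - p' \<in> A})"
  define R where "R s = {b \<in> A. s + b \<in> A}" for s
  have r: "r s = card (R s)" for s by (simp add: r_def reps_def R_def)
  have finCR: "finite (C pp)" "finite (R s)" for pp s
    using finA by (auto simp: C_def R_def split: prod.split)
  define g where "g = (\<lambda>(t, x). {y \<in> A. t + y \<in> A \<and> x - y \<in> P})"
  have fing: "finite (g l)" for l using finA by (auto simp: g_def split: prod.split)
  let ?\<delta> = "\<lambda>pp. snd pp - fst pp"
  have "fork P = (\<Sum>l\<in>\<Delta>\<times>A. real (card (g l \<times> g l)))"
    unfolding fork_def g_def
    by (intro sum.cong) (auto simp: card_cartesian_product power2_eq_square)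
  also have "\<dots> = real (card (SIGMA l:\<Delta>\<times>A. g l \<times> g l))"
    using finA finite_differences fing by simp
  also have "\<dots> \<le> real (card (SIGMA pp:P\<times>P. C pp \<times> R (?\<delta> pp)))"
  proof (intro of_nat_mono card_inj_on_le[of "\<lambda>((t, x), (y, y')). ((x - y, x - y'), (x, t + y'))"])
    show "inj_on (\<lambda>((t, x), (y, y')). ((x - y, x - y'), (x, t + y'))) (SIGMA l:\<Delta>\<times>A. g l \<times> g l)"
      by (auto simp: inj_on_def)
    show "(\<lambda>((t, x), (y, y')). ((x - y, x - y'), (x, t + y'))) ` (SIGMA l:\<Delta>\<times>A. g l \<times> g l)
        \<subseteq> (SIGMA pp:P\<times>P. C pp \<times> R (?\<delta> pp))"
      by (auto simp: g_def C_def R_def algebra_simps)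
  qed (use finP finCR in auto)
  also have "\<dots> = (\<Sum>pp\<in>P\<times>P. real (card (C pp)) * real (r (?\<delta> pp)))"
    using finP finCR by (simp add: card_cartesian_product r)
  finally have "(fork P)\<^sup>2 \<le> (\<Sum>pp\<in>P\<times>P. real (card (C pp)) * real (r (?\<delta> pp)))\<^sup>2"
    by (rule power_mono) (auto simp: fork_def intro: sum_nonneg)
  also have "\<dots> \<le> (\<Sum>pp\<in>P\<times>P. (real (card (C pp)))\<^sup>2) * (\<Sum>pp\<in>P\<times>P. (real (r (?\<delta> pp)))\<^sup>2)"
    by (rule Cauchy_Schwarz_ineq_sum)
  also have "\<dots> \<le> (d * real (card A) ^ 3) * (\<Sum>pp\<in>P\<times>P. (real (r (?\<delta> pp)))\<^sup>2)"
  proof (rule mult_right_mono)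
    have "(\<Sum>pp\<in>P\<times>P. (real (card (C pp)))\<^sup>2) = real (card (SIGMA pp:P\<times>P. C pp \<times> C pp))"
      using finP finCR by (simp add: card_cartesian_product power2_eq_square)
    also have "\<dots> \<le> real (card (SIGMA s:\<Delta>. R s \<times> R s \<times> R s))"
    proof (intro of_nat_mono
        card_inj_on_le[of "\<lambda>((p, p'), (x, x')). (x - x', x', x' - p, x' - p')"])
      show "inj_on (\<lambda>((p, p'), (x, x')). (x - x', x', x' - p, x' - p')) (SIGMA pp:P\<times>P. C pp \<times> C pp)"
        by (auto simp: inj_on_def)
      show "(\<lambda>((p, p'), (x, x')). (x - x', x', x' - p, x' - p')) ` (SIGMA pp:P\<times>P. C pp \<times> C pp)
          \<subseteq> (SIGMA s:\<Delta>. R s \<times> R s \<times> R s)"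
        using differences_mem by (auto simp: C_def R_def algebra_simps)
    qed (use finite_differences finCR in auto)
    also have "\<dots> = (\<Sum>s\<in>\<Delta>. real (r s) ^ 3)"
      using finite_differences finCR by (simp add: card_cartesian_product r power3_eq_cube mult.assoc)
    also have "\<dots> \<le> d * real (card A) ^ 3" by (rule sum_reps_cube_le[OF finite_differences])
    finally show "(\<Sum>pp\<in>P\<times>P. (real (card (C pp)))\<^sup>2) \<le> d * real (card A) ^ 3" .
  qed (auto intro: sum_nonneg)
  finally show ?thesis by (simp add: case_prod_beta)
qed

text \<open>
  Each \<open>p'\<close> has \<open>\<tau>\<close> representations \<open>a - b\<close>, and \<open>p' - p = x\<close> turns them into solutions
  of \<open>a - p = x + b\<close>, which are counted by the energies of \<open>A\<close> with \<open>P\<close> and with \<open>- X\<close>.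
\<close>

lemma popular_pairs_bound:
  assumes P: "P \<subseteq> \<Delta>" "\<And>s. s \<in> P \<Longrightarrow> \<tau> \<le> r s" and X: "finite X"
  shows "(real \<tau> * real (card {(p, p'). p \<in> P \<and> p' \<in> P \<and> p' - p \<in> X})) ^ 4
    \<le> d\<^sup>2 * real (card A) ^ 4 * real (card P) ^ 3 * real (card X) ^ 3"
proof -
  have finP: "finite P" using P finite_differences finite_subset by blast
  define V where "V = {(p, p'). p \<in> P \<and> p' \<in> P \<and> p' - p \<in> X}"
  have finV: "finite V" unfolding V_def by (rule finite_subset[of _ "P \<times> P"]) (use finP in auto)
  define X' where "X' = uminus ` X"
  have X': "finite X'" "card X' = card X" using X by (simp_all add: X'_def card_image)
  \<comment> \<open>For u = p' + b - p both u + p = p' + b and u + (p - p') = b lie in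
    \<open>A\<close>; the second relation is the reason for negating \<open>X\<close>.\<close>
  define F where "F u = {p \<in> P. u + p \<in> A}" for u
  define H where "H u = {z \<in> X'. u + z \<in> A}" for u
  define U where "U = (\<lambda>((p, p'), b). p' + b - p) ` (V \<times> A)"
  have fin: "finite U" "finite (F u)" "finite (H u)" for u
    using finV finA finP X' by (simp_all add: U_def F_def H_def)
  have "\<tau> * card V \<le> (\<Sum>v\<in>V. r (snd v))"
    using sum_bounded_below[of V \<tau> "\<lambda>v. r (snd v)"] P by (auto simp: V_def mult.commute)
  also have "\<dots> = card (SIGMA v:V. {b \<in> A. snd v + b \<in> A})"
    using finV finA by (simp add: r_def reps_def)
  also have "\<dots> \<le> card (SIGMA u:U. F u \<times> H u)"
  proof (intro card_inj_on_le[of "\<lambda>((p, p'), b). (p' + b - p, p, p - p')"])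
    show "inj_on (\<lambda>((p, p'), b). (p' + b - p, p, p - p')) (SIGMA v:V. {b \<in> A. snd v + b \<in> A})"
      by (auto simp: inj_on_def)
    show "(\<lambda>((p, p'), b). (p' + b - p, p, p - p')) ` (SIGMA v:V. {b \<in> A. snd v + b \<in> A})
        \<subseteq> (SIGMA u:U. F u \<times> H u)"
    proof clarsimp
      fix p p' b assume "(p, p') \<in> V" "b \<in> A" "p' + b \<in> A"
      moreover have "p - p' \<in> X'" if "p' - p \<in> X"
        using imageI[OF that, of uminus] by (simp add: X'_def)
      ultimately show "p' + b - p \<in> U \<and> p \<in> F (p' + b - p) \<and> p - p' \<in> H (p' + b - p)"
        by (auto simp: U_def F_def H_def V_def intro!: rev_image_eqI[of "((p, p'), b)"])
    qed
  qed (use fin in auto)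
  also have "\<dots> = (\<Sum>u\<in>U. reps (+) A P u * reps (+) A X' u)"
    using fin by (simp add: card_cartesian_product reps_def F_def H_def)
  finally have "real \<tau> * real (card V) \<le> (\<Sum>u\<in>U. real (reps (+) A P u) * real (reps (+) A X' u))"
    by (simp flip: of_nat_mult of_nat_sum)
  then have "(real \<tau> * real (card V))\<^sup>2
      \<le> (\<Sum>u\<in>U. real (reps (+) A P u) * real (reps (+) A X' u))\<^sup>2"
    by (intro power_mono) auto
  also have "\<dots> \<le> (\<Sum>u\<in>U. (real (reps (+) A P u))\<^sup>2) * (\<Sum>u\<in>U. (real (reps (+) A X' u))\<^sup>2)"
    by (rule Cauchy_Schwarz_ineq_sum)
  finally have "((real \<tau> * real (card V))\<^sup>2)\<^sup>2
      \<le> ((\<Sum>u\<in>U. (real (reps (+) A P u))\<^sup>2) * (\<Sum>u\<in>U. (real (reps (+) A X' u))\<^sup>2))\<^sup>2"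
    by (intro power_mono) auto
  also have "\<dots> = (\<Sum>u\<in>U. (real (reps (+) A P u))\<^sup>2)\<^sup>2 * (\<Sum>u\<in>U. (real (reps (+) A X' u))\<^sup>2)\<^sup>2"
    by (simp add: power_mult_distrib)
  also have "\<dots> \<le> (d * real (card A) ^ 2 * real (card P) ^ 3) * (d * real (card A) ^ 2 * real (card X') ^ 3)"
  proof (intro mult_mono)
    show 1: "(\<Sum>u\<in>U. (real (reps (+) A P u))\<^sup>2)\<^sup>2 \<le> d * real (card A) ^ 2 * real (card P) ^ 3"
      using finA finP fin contr by (intro controlled_energy) auto
    show "(\<Sum>u\<in>U. (real (reps (+) A X' u))\<^sup>2)\<^sup>2 \<le> d * real (card A) ^ 2 * real (card X') ^ 3"
      using finA X' fin contr by (intro controlled_energy) auto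
    show "0 \<le> d * real (card A) ^ 2 * real (card P) ^ 3" using 1 zero_le_power2 order_trans by blast
  qed auto
  also have "((real \<tau> * real (card V))\<^sup>2)\<^sup>2 = (real \<tau> * real (card V)) ^ 4"
    by (simp flip: power_mult)
  finally show ?thesis
    by (simp add: V_def X' power2_eq_square power4_eq_xxxx ac_simps)
qed

text \<open>On one dyadic level k of r (p' - p), with level set \<open>X\<close>, the bound for
  popular pairs leaves k^8 \<open>(card X)^3\<close>. This splits as (k^2 \<open>card X\<close>)
  (k^3 \<open>card X\<close>)^2, bounded by the energy and by the square of the cubic energy
  bound.\<close>

lemma pairs_energy_bound:
  assumes P: "P \<subseteq> \<Delta>" "\<And>s. s \<in> P \<Longrightarrow> \<tau> \<le> r s" and d: "0 \<le> d" and L: "card A < 2 ^ L"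
  shows "real \<tau> ^ 4 * (\<Sum>(p, p')\<in>P \<times> P. real (r (p' - p)) ^ 2) ^ 4
    \<le> 256 * real L ^ 4 * E * d ^ 4 * real (card A) ^ 10 * real (card P) ^ 3"
proof -
  have finP: "finite P" using P finite_differences finite_subset by blast
  have E0: "0 \<le> E" by (simp add: E_def sum_nonneg)
  let ?\<rho> = "\<lambda>v. r (snd v - fst v)"
  define W where "W = {v \<in> P \<times> P. 1 \<le> ?\<rho> v}"
  have finW: "finite W" using finP by (simp add: W_def)
  have S: "(\<Sum>(p, p')\<in>P \<times> P. real (r (p' - p)) ^ 2) = (\<Sum>v\<in>W. real (?\<rho> v) ^ 2)"
    unfolding W_def case_prod_beta using finP
    by (intro sum.mono_neutral_right) (auto simp: not_less_eq_eq)
  show ?thesis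
  proof (cases "0 < (\<Sum>v\<in>W. real (?\<rho> v) ^ 2)")
    case False
    moreover have "0 \<le> (\<Sum>v\<in>W. real (?\<rho> v) ^ 2)" by (intro sum_nonneg) auto
    ultimately have "(\<Sum>v\<in>W. real (?\<rho> v) ^ 2) = 0" by linarith
    then show ?thesis using S E0 d by simp
  next
    case True
    obtain j where j: "(\<Sum>v\<in>W. real (?\<rho> v) ^ 2)
      \<le> real L * (\<Sum>v | v \<in> W \<and> 2 ^ j \<le> ?\<rho> v \<and> ?\<rho> v < 2 ^ Suc j. real (?\<rho> v) ^ 2)"
    proof (rule dyadic_pigeonhole[of W ?\<rho> L "\<lambda>v. real (?\<rho> v) ^ 2"])
      show "?\<rho> v < 2 ^ L" for v
        using reps_le_right[OF finA, of "(+)" A] L unfolding r_def by (rule le_less_trans)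
    qed (use finW True in \<open>auto simp: W_def\<close>)
    define k where "k = (2::nat) ^ j"
    define X where "X = {s \<in> \<Delta>. k \<le> r s \<and> r s < 2 * k}"
    have finX: "finite X" using finite_differences by (simp add: X_def)
    define V where "V = {(p, p'). p \<in> P \<and> p' \<in> P \<and> p' - p \<in> X}"
    have V: "{v. v \<in> W \<and> 2 ^ j \<le> ?\<rho> v \<and> ?\<rho> v < 2 ^ Suc j} = V"
      using differences_memI by (fastforce simp: V_def X_def W_def k_def)
    have "(\<Sum>v\<in>V. real (?\<rho> v) ^ 2) \<le> (\<Sum>v\<in>V. (2 * real k) ^ 2)"
    proof (intro sum_mono power_mono)
      fix v assume "v \<in> V"
      then have "?\<rho> v < 2 * k" by (auto simp: V_def X_def)
      then show "real (?\<rho> v) \<le> 2 * real k" by linarith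
    qed simp
    also have "\<dots> = 4 * (real k ^ 2 * card V)" by (simp add: power_mult_distrib)
    finally have "real L * (\<Sum>v\<in>V. real (?\<rho> v) ^ 2) \<le> real L * (4 * (real k ^ 2 * card V))"
      by (rule mult_left_mono) simp
    with j[unfolded V] have "(\<Sum>v\<in>W. real (?\<rho> v) ^ 2) \<le> real L * (4 * (real k ^ 2 * card V))"
      by (rule order_trans)
    then have "(\<Sum>v\<in>W. real (?\<rho> v) ^ 2) ^ 4 \<le> (real L * (4 * (real k ^ 2 * card V))) ^ 4"
      by (rule power_mono) (auto intro: sum_nonneg)
    then have "real \<tau> ^ 4 * (\<Sum>v\<in>W. real (?\<rho> v) ^ 2) ^ 4
        \<le> real \<tau> ^ 4 * (real L * (4 * (real k ^ 2 * card V))) ^ 4"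
      by (rule mult_left_mono) simp
    also have "\<dots> = 256 * real L ^ 4 * real k ^ 8 * (real \<tau> * card V) ^ 4"
      by (simp add: power_mult_distrib flip: power_mult)
    also have "\<dots> \<le> 256 * real L ^ 4 * real k ^ 8
        * (d\<^sup>2 * real (card A) ^ 4 * real (card P) ^ 3 * real (card X) ^ 3)"
      using popular_pairs_bound[OF P finX] by (intro mult_left_mono) (simp_all add: V_def)
    also have "\<dots> = 256 * real L ^ 4 * d\<^sup>2 * real (card A) ^ 4 * real (card P) ^ 3
        * ((real k ^ 2 * card X) * (real k ^ 3 * card X)\<^sup>2)"
      by (simp add: power_mult_distrib power_numeral_reduce)
    also have "\<dots> \<le> 256 * real L ^ 4 * d\<^sup>2 * real (card A) ^ 4 * real (card P) ^ 3
        * (E * (d * real (card A) ^ 3)\<^sup>2)"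
    proof -
      have "real k ^ 2 * card X = (\<Sum>s\<in>X. real k ^ 2)" by simp
      also have "\<dots> \<le> (\<Sum>s\<in>X. real (r s) ^ 2)" by (intro sum_mono power_mono) (auto simp: X_def)
      also have "\<dots> \<le> E" unfolding energy_eq using finite_differences by (intro sum_mono2) (auto simp: X_def)
      finally have k2: "real k ^ 2 * card X \<le> E" .
      have "real k ^ 3 * card X = (\<Sum>s\<in>X. real k ^ 3)" by simp
      also have "\<dots> \<le> (\<Sum>s\<in>X. real (r s) ^ 3)" by (intro sum_mono power_mono) (auto simp: X_def)
      also have "\<dots> \<le> d * real (card A) ^ 3" by (rule sum_reps_cube_le[OF finX])
      finally have k3: "real k ^ 3 * card X \<le> d * real (card A) ^ 3" .
      show ?thesis
        by (rule mult_left_mono[OF mult_mono[OF k2 power_mono[OF k3]]]) (use d E0 in auto)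
    qed
    also have "\<dots> = 256 * real L ^ 4 * E * d ^ 4 * real (card A) ^ 10 * real (card P) ^ 3"
      by (simp add: power_mult_distrib power_numeral_reduce)
    finally show ?thesis unfolding S .
  qed
qed

text \<open>Eliminates the fork count T, the pair sum S, and the level \<tau> and size p of one
  popular set. Integer powers replace the exponents 7/13 and 32/13, that is 14/26 and 64/26.\<close>

lemma energy_bound_aux:
  assumes d: "0 \<le> d" and L: "card A < 2 ^ L"
  shows "E ^ 26 \<le> 2 ^ 46 * real L ^ 39 * d ^ 14 * real (card A) ^ 64"
proof (cases "0 < E")
  case False
  moreover have "0 \<le> E" by (simp add: E_def sum_nonneg)
  ultimately have "E = 0" by linarith
  then show ?thesis using d by simp
next
  case True
  define \<Delta>1 where "\<Delta>1 = {s \<in> \<Delta>. 1 \<le> r s}"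
  have E1: "E = (\<Sum>s\<in>\<Delta>1. real (r s) ^ 2)"
    unfolding energy_eq \<Delta>1_def using finite_differences by (intro sum.mono_neutral_right) (auto simp: not_less_eq_eq)
  obtain j where j: "E
    \<le> real L * (\<Sum>s | s \<in> \<Delta>1 \<and> 2 ^ j \<le> r s \<and> r s < 2 ^ Suc j. real (r s) ^ 2)"
  proof (rule dyadic_pigeonhole[of \<Delta>1 r L "\<lambda>s. real (r s) ^ 2"])
    show "r s < 2 ^ L" for s
      using reps_le_right[OF finA, of "(+)" A] L unfolding r_def by (rule le_less_trans)
  qed (use finite_differences True E1 in \<open>auto simp: \<Delta>1_def\<close>)
  define \<tau> where "\<tau> = (2::nat) ^ j"
  define P where "P = {s. s \<in> \<Delta>1 \<and> 2 ^ j \<le> r s \<and> r s < 2 ^ Suc j}"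
  have P: "P \<subseteq> \<Delta>" "\<And>s. s \<in> P \<Longrightarrow> \<tau> \<le> r s" "\<And>s. s \<in> P \<Longrightarrow> r s < 2 * \<tau>"
    by (auto simp: P_def \<Delta>1_def \<tau>_def)
  have finP: "finite P" using P finite_differences finite_subset by blast
  define l n t p T S e where "l = real L" and "n = real (card A)" and "t = real \<tau>" and "p = real (card P)"
    and "T = fork P" and "S = (\<Sum>(p, p')\<in>P \<times> P. real (r (p' - p)) ^ 2)" and "e = real (\<Sum>s\<in>P. r s)"
  have nn: "0 \<le> l" "0 \<le> n" "1 \<le> t" "0 \<le> p" "0 \<le> T" "0 \<le> S" "0 \<le> e"
    by (auto simp: l_def n_def t_def p_def T_def S_def e_def \<tau>_def fork_def intro!: sum_nonneg)
  have r2: "real (r s) \<le> 2 * t" if "s \<in> P" for s using P(3)[OF that] by (simp add: t_def)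
  have "(\<Sum>s\<in>P. real (r s) ^ 2) \<le> (\<Sum>s\<in>P. (2 * t) * real (r s))"
    using r2 by (intro sum_mono) (auto simp: power2_eq_square intro!: mult_right_mono)
  also have "\<dots> = 2 * t * e" by (simp add: e_def sum_distrib_left)
  finally have "l * (\<Sum>s\<in>P. real (r s) ^ 2) \<le> l * (2 * t * e)" using nn by (intro mult_left_mono)
  with j[folded P_def l_def] have Ee: "E \<le> l * (2 * t * e)" by (rule order_trans)
  have "e \<le> (\<Sum>s\<in>P. 2 * t)" unfolding e_def of_nat_sum using r2 by (intro sum_mono) auto
  then have "e \<le> 2 * t * p" by (simp add: p_def mult.commute)
  then have "l * (2 * t * e) \<le> l * (2 * t * (2 * t * p))" using nn by (intro mult_left_mono) auto
  with Ee have Ep: "E \<le> 4 * l * t\<^sup>2 * p" by (simp add: power2_eq_square ac_simps)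
  have "t ^ 3 * p = (\<Sum>s\<in>P. t ^ 3)" by (simp add: p_def)
  also have "\<dots> \<le> (\<Sum>s\<in>P. real (r s) ^ 3)"
    using P nn by (intro sum_mono power_mono) (auto simp: t_def)
  also have "\<dots> \<le> d * n ^ 3" using sum_reps_cube_le[OF finP] by (simp add: n_def)
  finally have tp: "t ^ 3 * p \<le> d * n ^ 3" .
  have low: "t\<^sup>2 * e ^ 4 \<le> n ^ 3 * T * E"
    using fork_lower[OF P(1,2)] by (simp add: t_def e_def n_def T_def)
  have up: "T\<^sup>2 \<le> d * n ^ 3 * S"
    using fork_upper[OF P(1)] by (simp add: T_def n_def S_def)
  have pairs: "t ^ 4 * S ^ 4 \<le> 256 * l ^ 4 * E * d ^ 4 * n ^ 10 * p ^ 3"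
    using pairs_energy_bound[OF P(1,2) d L] by (simp add: t_def S_def l_def n_def p_def)
  have "t\<^sup>2 * E ^ 4 \<le> t\<^sup>2 * (l * (2 * t * e)) ^ 4"
    using Ee True by (intro mult_left_mono power_mono) auto
  also have "\<dots> = 16 * t ^ 4 * l ^ 4 * (t\<^sup>2 * e ^ 4)" by (simp add: power_mult_distrib power_numeral_reduce)
  also have "\<dots> \<le> 16 * t ^ 4 * l ^ 4 * (n ^ 3 * T * E)"
    using low nn by (intro mult_left_mono) auto
  finally have "(t\<^sup>2 * E) * E ^ 3 \<le> (t\<^sup>2 * E) * (16 * t\<^sup>2 * l ^ 4 * n ^ 3 * T)"
    by (simp add: power_numeral_reduce ac_simps)
  then have E3: "E ^ 3 \<le> 16 * t\<^sup>2 * l ^ 4 * n ^ 3 * T"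
    using nn True by (simp add: mult_le_cancel_left_pos)
  have "T ^ 8 = (T\<^sup>2) ^ 4" by (simp flip: power_mult)
  also have "\<dots> \<le> (d * n ^ 3 * S) ^ 4" using up by (rule power_mono) simp
  finally have "t ^ 4 * T ^ 8 \<le> t ^ 4 * (d * n ^ 3 * S) ^ 4" by (rule mult_left_mono) simp
  also have "\<dots> = d ^ 4 * n ^ 12 * (t ^ 4 * S ^ 4)" by (simp add: power_mult_distrib flip: power_mult)
  also have "\<dots> \<le> d ^ 4 * n ^ 12 * (256 * l ^ 4 * E * d ^ 4 * n ^ 10 * p ^ 3)"
    using pairs d nn by (intro mult_left_mono) auto
  also have "\<dots> = 256 * l ^ 4 * E * d ^ 8 * n ^ 22 * p ^ 3"
    by (simp add: power_numeral_reduce)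
  finally have T8: "t ^ 4 * T ^ 8 \<le> 256 * l ^ 4 * E * d ^ 8 * n ^ 22 * p ^ 3" .
  have "(E ^ 3) ^ 8 \<le> (16 * t\<^sup>2 * l ^ 4 * n ^ 3 * T) ^ 8"
    using E3 True by (intro power_mono) auto
  then have "t ^ 4 * E ^ 24 \<le> t ^ 4 * (16 * t\<^sup>2 * l ^ 4 * n ^ 3 * T) ^ 8"
    by (intro mult_left_mono) (simp_all flip: power_mult)
  also have "\<dots> = 2 ^ 32 * t ^ 16 * l ^ 32 * n ^ 24 * (t ^ 4 * T ^ 8)"
    by (simp add: power_mult_distrib flip: power_mult)
  also have "\<dots> \<le> 2 ^ 32 * t ^ 16 * l ^ 32 * n ^ 24 * (256 * l ^ 4 * E * d ^ 8 * n ^ 22 * p ^ 3)"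
    using T8 nn by (intro mult_left_mono) auto
  finally have 24: "t ^ 4 * E ^ 24
      \<le> 2 ^ 32 * t ^ 16 * l ^ 32 * n ^ 24 * (256 * l ^ 4 * E * d ^ 8 * n ^ 22 * p ^ 3)" .
  have "t * E \<le> t * (4 * l * t\<^sup>2 * p)" using Ep nn by (intro mult_left_mono) auto
  also have "\<dots> = 4 * l * (t ^ 3 * p)" by (simp add: power_numeral_reduce)
  also have "\<dots> \<le> 4 * l * (d * n ^ 3)" using tp nn by (intro mult_left_mono) auto
  finally have tE: "t * E \<le> 4 * l * (d * n ^ 3)" .
  \<comment> \<open>Multiplication by E^3 groups the surplus t^12 p^3 into (t^3 p)^3 (t E)^3, both
    factors being governed by the cubic energy. Cancelling t^4 E leaves 24 + 3 - 1 = 26, with 8 + 3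
    + 3 = 14 factors d.\<close>
  have "(t ^ 4 * E) * E ^ 26 = t ^ 4 * E ^ 24 * E ^ 3" by (simp add: power_add[symmetric] power_numeral_reduce)
  also have "\<dots> \<le> 2 ^ 32 * t ^ 16 * l ^ 32 * n ^ 24 * (256 * l ^ 4 * E * d ^ 8 * n ^ 22 * p ^ 3) * E ^ 3"
    using 24 True by (intro mult_right_mono) auto
  also have "\<dots> = (t ^ 4 * E) * (2 ^ 40 * l ^ 36 * n ^ 46 * d ^ 8 * ((t ^ 3 * p) ^ 3 * (t * E) ^ 3))"
    by (simp add: power_mult_distrib power_numeral_reduce)
  also have "\<dots> \<le> (t ^ 4 * E) * (2 ^ 40 * l ^ 36 * n ^ 46 * d ^ 8 * ((d * n ^ 3) ^ 3 * (4 * l * (d * n ^ 3)) ^ 3))"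
    by (rule mult_left_mono[OF mult_left_mono[OF mult_mono[OF power_mono[OF tp] power_mono[OF tE]]]])
      (use nn d True in auto)
  also have "\<dots> = (t ^ 4 * E) * (2 ^ 46 * l ^ 39 * d ^ 14 * n ^ 64)"
    by (simp add: power_mult_distrib power_numeral_reduce)
  finally have "E ^ 26 \<le> 2 ^ 46 * l ^ 39 * d ^ 14 * n ^ 64"
    using nn True by (simp add: mult_le_cancel_left_pos)
  then show ?thesis by (simp add: l_def n_def)
qed

end

lemma controlled_energy_improved:
  fixes A :: "'a::ab_group_add set"
  assumes "finite A" "controlled (+) d A" "0 \<le> d" "card A < 2 ^ L" "finite T"
  shows "(\<Sum>x\<in>T. real (reps (+) A A x) ^ 2) ^ 26
    \<le> 2 ^ 46 * real L ^ 39 * d ^ 14 * real (card A) ^ 64"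
proof -
  let ?\<Delta> = "(\<lambda>(a, b). a - b) ` (A \<times> A)"
  have "(\<Sum>x\<in>T. real (reps (+) A A x) ^ 2) = (\<Sum>x\<in>T \<inter> ?\<Delta>. real (reps (+) A A x) ^ 2)"
    using assms(5) differences_memI[OF assms(1,2)] by (intro sum.mono_neutral_right) auto
  also have "\<dots> \<le> (\<Sum>x\<in>?\<Delta>. real (reps (+) A A x) ^ 2)"
    using assms(1) by (intro sum_mono2) auto
  finally have "(\<Sum>x\<in>T. real (reps (+) A A x) ^ 2) ^ 26
      \<le> (\<Sum>x\<in>?\<Delta>. real (reps (+) A A x) ^ 2) ^ 26"
    by (rule power_mono) (auto intro: sum_nonneg)
  also have "\<dots> \<le> 2 ^ 46 * real L ^ 39 * d ^ 14 * real (card A) ^ 64"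
    using energy_bound_aux[OF assms(1-4)] .
  finally show ?thesis .
qed

section \<open>Transfer to nonzero reals and extended energies\<close>

lemma reps_hom_image:
  fixes h :: "'a \<Rightarrow> 'b"
  assumes "inj h" "\<And>x y. h (f x y) = g (h x) (h y)"
  shows "reps g (h ` A) (h ` X) (h x) = reps f A X x"
proof -
  have "{c \<in> h ` X. g (h x) c \<in> h ` A} = h ` {b \<in> X. f x b \<in> A}"
    by (auto simp flip: assms(2) dest!: injD[OF assms(1)])
  then show ?thesis
    unfolding reps_def using card_image[OF inj_on_subset[OF assms(1) subset_UNIV]] by metis
qed

text \<open>The second component records the sign: multiplication of signs is addition in
  \<open>bit\<close>.\<close>

definition signed_exp :: "real \<times> bit \<Rightarrow> real" where
  "signed_exp = (\<lambda>(u, s). if s = 0 then exp u else - exp u)"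

lemma signed_exp_add: "signed_exp (x + y) = signed_exp x * signed_exp y"
  by (cases x; cases y) (auto simp: signed_exp_def exp_add)

lemma signed_exp_eq_iff: "signed_exp x = signed_exp y \<longleftrightarrow> x = y"
proof -
  have "exp u \<noteq> - exp v" "- exp v \<noteq> exp u" for u v :: real
    using exp_gt_zero[of u] exp_gt_zero[of v] by linarith+
  then show ?thesis by (cases x; cases y) (auto simp: signed_exp_def)
qed

lemma inj_signed_exp: "inj signed_exp"
  by (simp add: inj_def signed_exp_eq_iff)

lemma range_signed_exp: "range signed_exp = - {0}"
proof
  show "range signed_exp \<subseteq> - {0}" by (auto simp: signed_exp_def split: if_splits)
  show "- {0} \<subseteq> range signed_exp"
  proof
    fix x :: real assume "x \<in> - {0}"
    then have "x = signed_exp (ln \<bar>x\<bar>, if x > 0 then 0 else 1)" by (auto simp: signed_exp_def)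
    then show "x \<in> range signed_exp" by blast
  qed
qed

text \<open>
  The energy bound for \<^term>\<open>(*)\<close> is the one for abelian groups, read in the group
  \<^typ>\<open>real \<times> bit\<close>, which is isomorphic to the group of nonzero reals.
\<close>

lemma controlled_mult_energy_improved:
  fixes A T :: "real set"
  assumes fin: "finite A" "finite T" and A0: "0 \<notin> A" and c: "controlled (*) d A"
    and d: "0 \<le> d" and L: "card A < 2 ^ L"
  shows "(\<Sum>x\<in>T. real (reps (*) A A x) ^ 2) ^ 26
    \<le> 2 ^ 46 * real L ^ 39 * d ^ 14 * real (card A) ^ 64"
proof -
  define A' T' where "A' = signed_exp -` A" and "T' = signed_exp -` T"
  have img: "signed_exp ` A' = A" "signed_exp ` T' = T - {0}"
    using A0 by (auto simp: A'_def T'_def image_vimage_eq range_signed_exp)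
  have fin': "finite A'" "finite T'"
    unfolding A'_def T'_def using fin inj_signed_exp by (simp_all add: finite_vimageI)
  have card_img: "card (signed_exp ` X) = card X" for X
    by (rule card_image[OF inj_on_subset[OF inj_signed_exp subset_UNIV]])
  have card: "card A' = card A"
    using card_img[of A'] unfolding img by (rule sym)
  have reps: "reps (*) (signed_exp ` U) (signed_exp ` X) (signed_exp x) = reps (+) U X x" for U X x
    by (rule reps_hom_image[where f = "(+)", OF inj_signed_exp]) (rule signed_exp_add)
  have sum: "(\<Sum>x\<in>signed_exp ` S. real (reps (*) (signed_exp ` U) (signed_exp ` X) x) ^ k)
      = (\<Sum>x\<in>S. real (reps (+) U X x) ^ k)" for S U X k
    by (subst sum.reindex[OF inj_on_subset[OF inj_signed_exp subset_UNIV]]) (simp add: reps)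
  have "controlled (+) d A'"
    unfolding controlled_def
  proof (intro allI impI)
    fix X S :: "(real \<times> bit) set" assume XS: "finite X" "finite S"
    have "(\<Sum>x\<in>signed_exp ` S. real (reps (*) A (signed_exp ` X) x) ^ 3)
        \<le> d * card A * real (card (signed_exp ` X)) ^ 2"
      using c XS unfolding controlled_def by blast
    also have "card (signed_exp ` X) = card X" by (rule card_img)
    finally show "(\<Sum>x\<in>S. real (reps (+) A' X x) ^ 3) \<le> d * card A' * real (card X) ^ 2"
      using sum[where S = S and U = A' and X = X and k = 3] by (simp add: img card)
  qed
  then have "(\<Sum>x\<in>T'. real (reps (+) A' A' x) ^ 2) ^ 26
      \<le> 2 ^ 46 * real L ^ 39 * d ^ 14 * real (card A) ^ 64"
    using controlled_energy_improved[of A' d L T'] fin' d L card by simp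
  moreover have "(\<Sum>x\<in>T. real (reps (*) A A x) ^ 2) = (\<Sum>x\<in>T'. real (reps (+) A' A' x) ^ 2)"
  proof -
    \<comment> \<open>\<open>T\<close> may contain 0, which is outside the range of
      \<open>signed_exp\<close>; it contributes nothing because 0 is not in
      \<open>A\<close>.\<close>
    have "reps (*) A A 0 = 0" using A0 by (simp add: reps_def)
    then have "(\<Sum>x\<in>T. real (reps (*) A A x) ^ 2) = (\<Sum>x\<in>T - {0}. real (reps (*) A A x) ^ 2)"
      using fin by (intro sum.mono_neutral_right) auto
    also have "\<dots> = (\<Sum>x\<in>T'. real (reps (+) A' A' x) ^ 2)"
      using sum[where S = T' and U = A' and X = A' and k = 2] by (simp add: img)
    finally show ?thesis .
  qed
  ultimately show ?thesis by simp
qed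

section \<open>Passage to the extended-real energies\<close>

lemma r_diff_eq_reps: "r_diff A B = reps (+) A B"
proof
  fix x
  have "{(a, b). a \<in> A \<and> b \<in> B \<and> x = a - b} = (\<lambda>b. (x + b, b)) ` {b \<in> B. x + b \<in> A}"
    by force
  then show "r_diff A B x = reps (+) A B x"
    unfolding r_diff_def reps_def by (simp add: card_image inj_on_def)
qed

lemma r_quot_eq_reps: "r_quot A B = reps (*) A B"
proof
  fix x
  have "{(a, b). a \<in> A \<and> b \<in> B \<and> a = x * b} = (\<lambda>b. (x * b, b)) ` {b \<in> B. x * b \<in> A}"
    by force
  then show "r_quot A B x = reps (*) A B x"
    unfolding r_quot_def reps_def by (simp add: card_image inj_on_def)
qed

text \<open>In \<open>ennreal\<close> the infinite sum is the supremum of its finite partial sums,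
  so the uniform bounds over finite \<open>T\<close> suffice.\<close>

lemma infsum_power_le_ennreal:
  fixes g :: "'a \<Rightarrow> nat"
  assumes "\<And>T. finite T \<Longrightarrow> (\<Sum>x\<in>T. real (g x) ^ k) \<le> c"
  shows "(\<Sum>\<^sub>\<infinity>x\<in>UNIV. of_nat (g x) ^ k) \<le> ennreal c"
proof -
  have "(\<Sum>x\<in>T. (of_nat (g x) :: ennreal) ^ k) \<le> ennreal c" if "finite T" for T
  proof -
    have "(\<Sum>x\<in>T. (of_nat (g x) :: ennreal) ^ k) = ennreal (\<Sum>x\<in>T. real (g x) ^ k)"
      by (simp add: ennreal_of_nat_eq_real_of_nat ennreal_power)
    then show ?thesis using assms[OF that] by (simp add: ennreal_leI)
  qed
  then show ?thesis
    by (subst nonneg_infsum_complete) (auto intro!: SUP_least)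
qed

lemma ennreal_quotient_le:
  assumes "e \<le> ennreal (d * real a * real b ^ 2)" "0 \<le> d" "0 < b"
  shows "e / (of_nat a * of_nat b ^ 2) \<le> ennreal d"
proof (cases "a = 0")
  case True
  \<comment> \<open>Here e = 0, and the quotient 0 / 0 is 0.\<close>
  then show ?thesis using assms by simp
next
  case False
  have "of_nat a * of_nat b ^ 2 = ennreal (real a * real b ^ 2)"
    by (simp add: ennreal_of_nat_eq_real_of_nat ennreal_mult ennreal_power)
  moreover have "ennreal (d * real a * real b ^ 2) / ennreal (real a * real b ^ 2) = ennreal d"
    using assms False by (subst divide_ennreal) auto
  ultimately show ?thesis using divide_right_mono_ennreal[OF assms(1)] by metis
qed

lemma d_add_le:
  assumes "controlled (+) d A" "0 \<le> d"
  shows "d_add A \<le> ennreal d"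
  unfolding d_add_def E3_add_def r_diff_eq_reps
proof (intro SUP_least ennreal_quotient_le infsum_power_le_ennreal)
  fix B T :: "real set" assume "B \<in> {B. finite B \<and> B \<noteq> {}}" "finite T"
  then show "(\<Sum>x\<in>T. real (reps (+) A B x) ^ 3) \<le> d * real (card A) * real (card B) ^ 2"
    using assms by (simp add: controlled_def)
qed (use assms in \<open>auto simp: card_gt_0_iff\<close>)

lemma d_mult_le:
  assumes "controlled (*) d A" "0 \<le> d"
  shows "d_mult A \<le> ennreal d"
  unfolding d_mult_def E3_mult_def r_quot_eq_reps
proof (intro SUP_least ennreal_quotient_le infsum_power_le_ennreal)
  fix B T :: "real set" assume "B \<in> {B. finite B \<and> B \<noteq> {}}" "finite T"
  then show "(\<Sum>x\<in>T. real (reps (*) A B x) ^ 3) \<le> d * real (card A) * real (card B) ^ 2"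
    using assms by (simp add: controlled_def)
qed (use assms in \<open>auto simp: card_gt_0_iff\<close>)

lemma controlled_mono:
  fixes A :: "'a set"
  assumes "controlled f d A" "d \<le> d'"
  shows "controlled f d' A"
  unfolding controlled_def
proof (intro allI impI)
  fix X T :: "'a set" assume "finite X" "finite T"
  with assms(1) have "(\<Sum>x\<in>T. real (reps f A X x) ^ 3) \<le> d * card A * real (card X) ^ 2"
    by (simp add: controlled_def)
  also have "\<dots> \<le> d' * card A * real (card X) ^ 2"
    using assms(2) by (intro mult_right_mono) auto
  finally show "(\<Sum>x\<in>T. real (reps f A X x) ^ 3) \<le> d' * card A * real (card X) ^ 2" .
qed

section \<open>Logarithms, exponents and assembly\<close>

lemma exists_dyadic_exponent:
  assumes "2 \<le> N"
  obtains L where "N ^ 3 < 2 ^ L" "1 \<le> L" "real L \<le> 6 / ln 2 * ln (real N)"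
proof -
  obtain m where m: "2 ^ m \<le> N" "N < 2 ^ (m + 1)" using ex_power_ivl1[of 2 N] assms by auto
  have "N ^ 3 < (2 ^ (m + 1)) ^ 3" using m(2) by (intro power_strict_mono) auto
  then have "N ^ 3 < 2 ^ (3 * (m + 1))" by (metis mult.commute power_mult)
  moreover have "m * ln 2 \<le> ln (real N)"
  proof -
    have "(2::real) ^ m \<le> real N" using m(1) by (metis of_nat_le_iff of_nat_numeral of_nat_power)
    then have "ln ((2::real) ^ m) \<le> ln (real N)" by (intro ln_mono) auto
    then show ?thesis by (simp add: ln_realpow)
  qed
  moreover have "ln 2 \<le> ln (real N)" using assms by (intro ln_mono) auto
  \<comment> \<open>Since N >= 2, both m ln 2 and ln 2 are at most ln N; this is the source of 6 = 3
    * 2.\<close>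
  ultimately have "N ^ 3 < 2 ^ (3 * (m + 1))" "real (3 * (m + 1)) * ln 2 \<le> 6 * ln (real N)"
    by (auto simp: algebra_simps)
  then show ?thesis using that[of "3 * (m + 1)"] by (simp add: field_simps)
qed

lemma root_bound_mixed:
  fixes e d n :: real
  assumes "e\<^sup>2 \<le> d * s\<^sup>2 * n ^ 3" "d \<le> 2 ^ 22 * real L ^ 5 * sqrt n" "0 \<le> s" "s \<le> n" "0 < n" "1 \<le> L"
  shows "e \<le> 2 ^ 22 * real L ^ 5 * n powr (11 / 4)"
proof (rule power2_le_imp_le)
  have "d * s\<^sup>2 * n ^ 3 \<le> (2 ^ 22 * real L ^ 5 * sqrt n) * n\<^sup>2 * n ^ 3"
    using assms by (intro mult_right_mono mult_mono power_mono) auto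
  also have "\<dots> = 2 ^ 22 * real L ^ 5 * (sqrt n * n ^ 5)" by (simp add: power_numeral_reduce)
  also have "sqrt n * n ^ 5 = n powr (1 / 2) * n powr 5"
    using assms by (simp add: powr_half_sqrt powr_numeral)
  also have "\<dots> = n powr (11 / 2)" by (simp flip: powr_add)
  \<comment> \<open>The factor is at least 1, so it may be squared; the root then carries the same
    constant as the bound for d.\<close>
  also have "2 ^ 22 * real L ^ 5 * n powr (11 / 2) \<le> (2 ^ 22 * real L ^ 5)\<^sup>2 * n powr (11 / 2)"
  proof (rule mult_right_mono)
    have "1 \<le> real L ^ 5" using assms by (intro one_le_power) simp
    then have "1 \<le> 2 ^ 22 * real L ^ 5" by simp
    then show "2 ^ 22 * real L ^ 5 \<le> (2 ^ 22 * real L ^ 5)\<^sup>2"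
      using self_le_power[of "2 ^ 22 * real L ^ 5" 2] by simp
  qed simp
  also have "n powr (11 / 2) = (n powr (11 / 4))\<^sup>2"
    using assms by (simp add: powr_power)
  also have "(2 ^ 22 * real L ^ 5)\<^sup>2 * (n powr (11 / 4))\<^sup>2 = (2 ^ 22 * real L ^ 5 * n powr (11 / 4))\<^sup>2"
    by (rule power_mult_distrib[symmetric])
  finally show "e\<^sup>2 \<le> (2 ^ 22 * real L ^ 5 * n powr (11 / 4))\<^sup>2" using assms(1) by linarith
qed simp

lemma root_bound_energy:
  fixes e d n :: real
  assumes "e ^ 26 \<le> 2 ^ 46 * real L ^ 39 * d ^ 14 * s ^ 64" "0 \<le> d"
    "d \<le> 2 ^ 22 * real L ^ 5 * sqrt n" "0 \<le> s" "s \<le> n" "0 < n" "1 \<le> L"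
  shows "e \<le> 2 ^ 22 * real L ^ 5 * n powr (71 / 26)"
proof (rule power_le_imp_le_base)
  have "2 ^ 46 * real L ^ 39 * d ^ 14 * s ^ 64
      \<le> 2 ^ 46 * real L ^ 39 * (2 ^ 22 * real L ^ 5 * sqrt n) ^ 14 * n ^ 64"
    using assms by (intro mult_mono power_mono order_refl) auto
  also have "(2 ^ 22 * real L ^ 5 * sqrt n) ^ 14 = 2 ^ 308 * real L ^ 70 * n ^ 7"
  proof -
    have "sqrt n ^ 14 = ((sqrt n)\<^sup>2) ^ 7" by (simp flip: power_mult)
    then show ?thesis using assms by (simp add: power_mult_distrib flip: power_mult)
  qed
  also have "2 ^ 46 * real L ^ 39 * (2 ^ 308 * real L ^ 70 * n ^ 7) * n ^ 64
      = 2 ^ 354 * real L ^ 109 * n ^ 71"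
  proof -
    have "a39 * (a70 * n7) * n64 = (a39 * a70) * (n7 * n64)" for a39 a70 n7 n64 :: real by simp
    then show ?thesis by (simp add: power_add[symmetric])
  qed
  \<comment> \<open>Rounding up to 572 = 22 * 26 and 130 = 5 * 26 gives a 26th power with the same
    constant again.\<close>
  also have "\<dots> \<le> 2 ^ 572 * real L ^ 130 * n ^ 71"
    using assms by (intro mult_mono power_increasing order_refl) auto
  also have "\<dots> = (2 ^ 22 * real L ^ 5 * n powr (71 / 26)) ^ Suc 25"
  proof -
    have "(n powr (71 / 26)) ^ 26 = n powr 71" using assms by (simp add: powr_power)
    also have "\<dots> = n ^ 71" using assms by (simp add: powr_numeral)
    finally show ?thesis by (simp add: power_mult_distrib flip: power_mult)
  qed
  finally show "e ^ Suc 25 \<le> (2 ^ 22 * real L ^ 5 * n powr (71 / 26)) ^ Suc 25"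
    using assms(1) by simp
qed simp

text \<open>
  The zero of \<open>A\<close> is put into \<open>B\<close>, since the multiplicative energies of a set containing \<open>0\<close>
  are infinite.
\<close>

lemma exists_energy_partition:
  fixes A :: "real set"
  assumes fin: "finite A" and two: "2 \<le> card A" and L: "card A ^ 3 < 2 ^ L" "1 \<le> L"
  shows "\<exists>B C. B \<union> C = A \<and> B \<inter> C = {} \<and>
    max (d_add B) (d_mult C) \<le> ennreal (2 ^ 22 * real L ^ 5 * real (card A) powr (1 / 2)) \<and>
    max (E_add B B) (E_mult C C) \<le> ennreal (2 ^ 22 * real L ^ 5 * real (card A) powr (71 / 26)) \<and>
    max (E_add B A) (E_mult C A) \<le> ennreal (2 ^ 22 * real L ^ 5 * real (card A) powr (11 / 4))"
proof -
  define n where "n = real (card A)"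
  define d where "d = 2 ^ 22 * real L ^ 5 * sqrt n"
  have n: "2 \<le> n" using two by (simp add: n_def)
  have L1: "1 \<le> real L ^ 5" using L(2) by (intro one_le_power) simp
  \<comment> \<open>The 4 is the loss of \<open>controlled_insert\<close> when 0 joins
    \<open>B1\<close>.\<close>
  then have "4 * 1 \<le> 2 ^ 22 * real L ^ 5" by (intro mult_mono) auto
  then have "4 * sqrt n \<le> 2 ^ 22 * real L ^ 5 * sqrt n" using n by (intro mult_right_mono) auto
  then have d4: "4 * sqrt n \<le> d" by (simp add: d_def)
  have d0: "0 \<le> d" by (simp add: d_def n_def)
  have sq1: "1 \<le> sqrt n" using n by simp
  define A0 where "A0 = A - {0}"
  have A0: "finite A0" "0 \<notin> A0" "card A0 \<le> card A"
    using fin by (auto simp: A0_def intro: card_mono)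
  then have "card A0 ^ 3 < 2 ^ L" using L(1) power_mono[of "card A0" "card A" 3] by linarith
  from exists_controlled_partition[OF A0(1,2) sq1 this]
  obtain B1 C where BC: "B1 \<union> C = A0" "B1 \<inter> C = {}" "controlled (+) (sqrt n) B1"
    "controlled (*) (2 ^ 22 * real L ^ 5 / sqrt n * card A0) C" .
  define B where "B = B1 \<union> (A \<inter> {0})"
  have part: "B \<union> C = A" "B \<inter> C = {}" using BC by (auto simp: B_def A0_def)
  have C0: "0 \<notin> C" using BC A0 by auto
  have fBC: "finite B" "finite C" using part fin by auto
  have cards: "card B \<le> card A" "card C \<le> card A" using part fin by (auto intro: card_mono)
  have cardL: "card B < 2 ^ L" "card C < 2 ^ L"
  proof -
    have "card A \<le> card A ^ 3" using two by (intro self_le_power) auto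
    then show "card B < 2 ^ L" "card C < 2 ^ L" using cards L(1) by linarith+
  qed
  have cB: "controlled (+) d B"
  proof (cases "0 \<in> A")
    case True
    then have "B = insert 0 B1" by (auto simp: B_def)
    moreover have "0 \<notin> B1" "finite B1" using BC A0 by auto
    ultimately have "controlled (+) (4 * sqrt n) B" using controlled_insert BC(3) sq1 by blast
    then show ?thesis using d4 by (rule controlled_mono)
  next
    case False
    then have "B = B1" by (auto simp: B_def)
    moreover have "sqrt n \<le> d" using d4 sq1 by linarith
    ultimately show ?thesis using BC(3) controlled_mono by blast
  qed
  have cC: "controlled (*) d C"
  proof (rule controlled_mono[OF BC(4)])
    have "2 ^ 22 * real L ^ 5 / sqrt n * card A0 \<le> 2 ^ 22 * real L ^ 5 / sqrt n * n"
      using A0(3) by (intro mult_left_mono) (auto simp: n_def)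
    also have "\<dots> = 2 ^ 22 * real L ^ 5 * (n / sqrt n)" by simp
    also have "n / sqrt n = sqrt n" using n by (simp add: real_div_sqrt)
    finally show "2 ^ 22 * real L ^ 5 / sqrt n * card A0 \<le> d" by (simp add: d_def)
  qed
  have "d = 2 ^ 22 * real L ^ 5 * n powr (1 / 2)" using n by (simp add: d_def powr_half_sqrt)
  then have 1: "max (d_add B) (d_mult C) \<le> ennreal (2 ^ 22 * real L ^ 5 * n powr (1 / 2))"
    using d_add_le[OF cB d0] d_mult_le[OF cC d0] by simp
  have "E_add B B \<le> ennreal (2 ^ 22 * real L ^ 5 * n powr (71 / 26))"
    unfolding E_add_def r_diff_eq_reps
  proof (rule infsum_power_le_ennreal)
    fix T :: "real set" assume "finite T"
    from controlled_energy_improved[OF fBC(1) cB d0 cardL(1) this]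
    show "(\<Sum>x\<in>T. real (reps (+) B B x) ^ 2) \<le> 2 ^ 22 * real L ^ 5 * n powr (71 / 26)"
      by (rule root_bound_energy) (use d0 n cards L(2) in \<open>auto simp: d_def n_def\<close>)
  qed
  moreover have "E_mult C C \<le> ennreal (2 ^ 22 * real L ^ 5 * n powr (71 / 26))"
    unfolding E_mult_def r_quot_eq_reps
  proof (rule infsum_power_le_ennreal)
    fix T :: "real set" assume "finite T"
    from controlled_mult_energy_improved[OF fBC(2) this C0 cC d0 cardL(2)]
    show "(\<Sum>x\<in>T. real (reps (*) C C x) ^ 2) \<le> 2 ^ 22 * real L ^ 5 * n powr (71 / 26)"
      by (rule root_bound_energy) (use d0 n cards L(2) in \<open>auto simp: d_def n_def\<close>)
  qed
  ultimately have 2: "max (E_add B B) (E_mult C C) \<le> ennreal (2 ^ 22 * real L ^ 5 * n powr (71 / 26))"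
    by simp
  have "E_add B A \<le> ennreal (2 ^ 22 * real L ^ 5 * n powr (11 / 4))"
    unfolding E_add_def r_diff_eq_reps
  proof (rule infsum_power_le_ennreal)
    fix T :: "real set" assume "finite T"
    then have "(\<Sum>x\<in>T. real (reps (+) B A x) ^ 2)\<^sup>2 \<le> d * real (card B) ^ 2 * n ^ 3"
      unfolding n_def using fBC fin cB by (intro controlled_energy) auto
    then show "(\<Sum>x\<in>T. real (reps (+) B A x) ^ 2) \<le> 2 ^ 22 * real L ^ 5 * n powr (11 / 4)"
      by (rule root_bound_mixed) (use n cards L(2) in \<open>auto simp: d_def n_def\<close>)
  qed
  moreover have "E_mult C A \<le> ennreal (2 ^ 22 * real L ^ 5 * n powr (11 / 4))"
    unfolding E_mult_def r_quot_eq_reps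
  proof (rule infsum_power_le_ennreal)
    fix T :: "real set" assume "finite T"
    then have "(\<Sum>x\<in>T. real (reps (*) C A x) ^ 2)\<^sup>2 \<le> d * real (card C) ^ 2 * n ^ 3"
      unfolding n_def using fBC fin cC C0 by (intro controlled_energy) auto
    then show "(\<Sum>x\<in>T. real (reps (*) C A x) ^ 2) \<le> 2 ^ 22 * real L ^ 5 * n powr (11 / 4)"
      by (rule root_bound_mixed) (use n cards L(2) in \<open>auto simp: d_def n_def\<close>)
  qed
  ultimately have 3: "max (E_add B A) (E_mult C A) \<le> ennreal (2 ^ 22 * real L ^ 5 * n powr (11 / 4))"
    by simp
  show ?thesis using part 1 2 3 unfolding n_def by blast
qed

text \<open>Singletons are excluded because ln 1 = 0 would make the right-hand sides vanish, whereas
  the class containing the point has d at least 1.\<close>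

theorem theorem1p11:
  fixes \<delta> :: real
  assumes "\<delta> = 1 / 4"
  shows "\<exists>K c :: real. K > 0 \<and> c > 0 \<and>
    (\<forall>A :: real set. finite A \<and> card A \<ge> 2 \<longrightarrow>
      (\<exists>B C. B \<union> C = A \<and> B \<inter> C = {} \<and>
        max (d_add B) (d_mult C)
          \<le> ennreal (K * (real (card A) powr (1 - 2 * \<delta>) * ln (real (card A)) powr c)) \<and>
        max (E_add B B) (E_mult C C)
          \<le> ennreal (K * (real (card A) powr (3 - 14 / 13 * \<delta>) * ln (real (card A)) powr c)) \<and>
        max (E_add B A) (E_mult C A)
          \<le> ennreal (K * (real (card A) powr (3 - \<delta>) * ln (real (card A)) powr c))))"
proof -
  \<comment> \<open>\<open>L\<close> is at most 6 / ln 2 times the logarithm and enters through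
    \<open>L ^ 5\<close>, hence this constant and c = 5.\<close>
  define K :: real where "K = 2 ^ 22 * (6 / ln 2) ^ 5"
  have \<delta>: "1 - 2 * \<delta> = 1 / 2" "3 - 14 / 13 * \<delta> = 71 / 26" "3 - \<delta> = 11 / 4"
    using assms by simp_all
  have main: "\<exists>B C. B \<union> C = A \<and> B \<inter> C = {} \<and>
        max (d_add B) (d_mult C)
          \<le> ennreal (K * (real (card A) powr (1 / 2) * ln (real (card A)) powr 5)) \<and>
        max (E_add B B) (E_mult C C)
          \<le> ennreal (K * (real (card A) powr (71 / 26) * ln (real (card A)) powr 5)) \<and>
        max (E_add B A) (E_mult C A)
          \<le> ennreal (K * (real (card A) powr (11 / 4) * ln (real (card A)) powr 5))"
    if A: "finite A" "2 \<le> card A" for A :: "real set"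
  proof -
    obtain L where L: "card A ^ 3 < 2 ^ L" "1 \<le> L" "real L \<le> 6 / ln 2 * ln (real (card A))"
      using exists_dyadic_exponent[OF A(2)] .
    have "real L ^ 5 \<le> (6 / ln 2 * ln (real (card A))) ^ 5" using L(3) by (rule power_mono) simp
    also have "\<dots> = (6 / ln 2) ^ 5 * ln (real (card A)) powr 5"
      unfolding power_mult_distrib using A(2) by (simp add: powr_numeral)
    finally have L5: "real L ^ 5 \<le> (6 / ln 2) ^ 5 * ln (real (card A)) powr 5" .
    have bound: "ennreal (2 ^ 22 * real L ^ 5 * real (card A) powr \<alpha>)
        \<le> ennreal (K * (real (card A) powr \<alpha> * ln (real (card A)) powr 5))" for \<alpha>
    proof (rule ennreal_leI)
      have "2 ^ 22 * real L ^ 5 * real (card A) powr \<alpha>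
          \<le> 2 ^ 22 * ((6 / ln 2) ^ 5 * ln (real (card A)) powr 5) * real (card A) powr \<alpha>"
        using L5 by (intro mult_right_mono mult_left_mono) auto
      also have "\<dots> = K * (real (card A) powr \<alpha> * ln (real (card A)) powr 5)"
        by (simp add: K_def)
      finally show "2 ^ 22 * real L ^ 5 * real (card A) powr \<alpha>
          \<le> K * (real (card A) powr \<alpha> * ln (real (card A)) powr 5)" .
    qed
    from exists_energy_partition[OF A L(1,2)] show ?thesis using order_trans[OF _ bound] by blast
  qed
  show ?thesis unfolding \<delta>
  proof (rule exI[of _ K], rule exI[of _ 5], intro conjI allI impI)
    show "0 < K" by (simp add: K_def)
    show "(0::real) < 5" by simp
  qed (rule main; simp)
qed

end
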